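(* Let $\mathcal{K}\subset \mathcal{Q}_{\ll}(\mathbb{P})$ be a convex closed set and let $\psi:\mathcal{K}\rightarrow \mathbb{R}\cup\{+\infty\}$ be a function with $\inf_{\mathbb{Q}\in\mathcal{K}}\psi(\mathbb{Q})\in\mathbb{R}$. Extend $\psi$ to $\mathcal{Q}_{cont}$ by setting $\psi(\mathbb{Q}):=\infty$ for each $\mathbb{Q}\in\mathcal{Q}_{cont}\setminus\mathcal{K}$. Define the function $\Psi$, with domain in $L^1(\mathbb{P})$, by $\Psi(D):=\psi(\mathbb{Q})$ if $D=d\mathbb{Q}/d\mathbb{P}$ for some $\mathbb{Q}\in\mathcal{K}$, and $\Psi(D):=\infty$ otherwise. Let $\rho$ be the convex measure of risk associated with $\psi$, that is, $\rho(X):=\sup_{\mathbb{Q}\in\mathcal{Q}_{cont}}\{\mathbb{E}_{\mathbb{Q}}[-X]-\psi(\mathbb{Q})\}$ for $X\in\mathfrak{M}_b(\Omega,\mathcal{F})$, and let $\psi_\rho^\ast$ be its minimal penalty function. Then the following assertions hold. (a) If $\rho$ has as minimal penalty $\psi_\rho^\ast$ the function $\psi$ (i.e. $\psi=\psi_\rho^\ast$), then $\Psi$ is a proper convex function and lower semicontinuous with respect to the (strong) $L^1$-topology, or equivalently with respect to the weak topology $\sigma(L^1,L^\infty)$. (b) If $\Psi$ is lower semicontinuous with respect to the (strong) $L^1$-topology, or equivalently with respect to the weak topology $\sigma(L^1,L^\infty)$, then $\psi\mathbf{1}_{\mathcal{Q}_{\ll}(\mathbb{P})}=\psi_\rho^\ast\mathbf{1}_{\mathcal{Q}_{\ll}(\mathbb{P})}$,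 i.e. $\psi(\mathbb{Q})=\psi_\rho^\ast(\mathbb{Q})$ for every $\mathbb{Q}\in\mathcal{Q}_{\ll}(\mathbb{P})$.
   Context: $(\Omega,\mathcal{F},\mathbb{P})$ is a fixed probability space. $\mathfrak{M}_b=\mathfrak{M}_b(\Omega,\mathcal{F})$ is the space of bounded measurable real functions on $(\Omega,\mathcal{F})$. A probability content is a finitely additive set function $\mathbb{Q}:\mathcal{F}\to[0,1]$ with $\mathbb{Q}(\Omega)=1$; $\mathcal{Q}_{cont}$ is the set of all probability contents, and $\mathbb{E}_{\mathbb{Q}}[X]$ denotes the integral of $X\in\mathfrak{M}_b$ with respect to $\mathbb{Q}$. $\mathcal{Q}_{\ll}(\mathbb{P})\subset\mathcal{Q}_{cont}$ is the set of ($\sigma$-additive) probability measures on $(\Omega,\mathcal{F})$ absolutely continuous with respect to $\mathbb{P}$. Topological notions for a set $\mathcal{K}\subset\mathcal{Q}_{\ll}(\mathbb{P})$ refer to the corresponding set of densities $\{d\mathbb{Q}/d\mathbb{P}:\mathbb{Q}\in\mathcal{K}\}$ with the strong topology of $L^1(\mathbb{P})$; thus $\mathcal{K}$ closed means this set of densities is norm closed in $L^1(\mathbb{P})$. A convex risk measure is a map $\rho:\mathfrak{M}_b\to\mathbb{R}$ that is monotone ($X\le Y$ implies $\rho(X)\ge\rho(Y)$), translation invariant ($\rho(X+a)=\rho(X)-a$ for $a\in\mathbb{R}$) and convex. Its acceptance set is $\mathcal{A}_\rho:=\{X\in\mathfrak{M}_b:\rho(X)\le 0\}$ and its minimal penalty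 function is $\psi_\rho^\ast(\mathbb{Q}):=\sup_{X\in\mathcal{A}_\rho}\mathbb{E}_{\mathbb{Q}}[-X]$ for $\mathbb{Q}\in\mathcal{Q}_{cont}$.
   Formalization: In (b), and in its equivalence of strong and weak lower semicontinuity, Ψ is additionally assumed convex; without this (b) fails (two atoms, K all probabilities, ψ(p)=p(1−p)), and convexity is necessary for the conclusion of (b). *)

theory Defs
  imports "HOL-Probability.Probability"
begin

section \<open>Probability contents and their integral\<close>

definition bounded_measurable :: "'a measure \<Rightarrow> ('a \<Rightarrow> real) set" where
  "bounded_measurable M = {X \<in> borel_measurable M. \<exists>C. \<forall>x\<in>space M. \<bar>X x\<bar> \<le> C}"

text \<open>Set functions are extensional, i.e. \<^const>\<open>undefined\<close> outside the sigma-algebra, so that two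
  contents are equal as soon as they agree on all measurable sets.\<close>

definition prob_contents :: "'a measure \<Rightarrow> ('a set \<Rightarrow> real) set" where
  "prob_contents M = {Q \<in> sets M \<rightarrow>\<^sub>E {0..1}. additive (sets M) Q \<and> Q (space M) = 1}"

definition ac_prob_measures :: "'a measure \<Rightarrow> ('a set \<Rightarrow> real) set" where
  "ac_prob_measures M =
    {restrict (measure N) (sets M) |N. prob_space N \<and> sets N = sets M \<and> absolutely_continuous M N}"

definition simple_content_integral :: "'a measure \<Rightarrow> ('a set \<Rightarrow> real) \<Rightarrow> ('a \<Rightarrow> real) \<Rightarrow> real" where
  "simple_content_integral M Q s = (\<Sum>y\<in>s ` space M. y * Q (s -` {y} \<inter> space M))"

text \<open>For bounded measurable functions this supremum is the unique uniformly continuous extension of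
  the integral of simple functions; see \<open>content_integral_approx\<close> and
  \<open>simple_approx_uniform\<close> below.\<close>

definition content_integral :: "'a measure \<Rightarrow> ('a set \<Rightarrow> real) \<Rightarrow> ('a \<Rightarrow> real) \<Rightarrow> real" where
  "content_integral M Q X =
    Sup {simple_content_integral M Q s |s. simple_function M s \<and> (\<forall>x\<in>space M. s x \<le> X x)}"


section \<open>Convex risk measures\<close>

definition convex_risk_measure :: "'a measure \<Rightarrow> (('a \<Rightarrow> real) \<Rightarrow> real) \<Rightarrow> bool" where
  "convex_risk_measure M \<rho> \<longleftrightarrow>
    (\<forall>X\<in>bounded_measurable M. \<forall>Y\<in>bounded_measurable M.
       (\<forall>x\<in>space M. X x \<le> Y x) \<longrightarrow> \<rho> Y \<le> \<rho> X) \<and>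
    (\<forall>X\<in>bounded_measurable M. \<forall>a. \<rho> (\<lambda>x. X x + a) = \<rho> X - a) \<and>
    (\<forall>X\<in>bounded_measurable M. \<forall>Y\<in>bounded_measurable M. \<forall>t\<in>{0..1}.
       \<rho> (\<lambda>x. t * X x + (1 - t) * Y x) \<le> t * \<rho> X + (1 - t) * \<rho> Y)"

definition acceptance_set :: "'a measure \<Rightarrow> (('a \<Rightarrow> real) \<Rightarrow> real) \<Rightarrow> ('a \<Rightarrow> real) set" where
  "acceptance_set M \<rho> = {X \<in> bounded_measurable M. \<rho> X \<le> 0}"

definition minimal_penalty ::
    "'a measure \<Rightarrow> (('a \<Rightarrow> real) \<Rightarrow> real) \<Rightarrow> ('a set \<Rightarrow> real) \<Rightarrow> ereal" where
  "minimal_penalty M \<rho> Q = (SUP X\<in>acceptance_set M \<rho>. ereal (content_integral M Q (\<lambda>x. - X x)))"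

text \<open>The supremum is a real number whenever the infimum of the penalty is; see
  \<open>risk_measure_of_eq_SUP\<close> and \<open>convex_risk_measure_risk_measure_of\<close> below.\<close>

definition risk_measure_of ::
    "'a measure \<Rightarrow> (('a set \<Rightarrow> real) \<Rightarrow> ereal) \<Rightarrow> ('a \<Rightarrow> real) \<Rightarrow> real" where
  "risk_measure_of M \<phi> X =
    real_of_ereal (SUP Q\<in>prob_contents M. ereal (content_integral M Q (\<lambda>x. - X x)) - \<phi> Q)"

definition extend_penalty ::
    "('a set \<Rightarrow> real) set \<Rightarrow> (('a set \<Rightarrow> real) \<Rightarrow> ereal) \<Rightarrow> ('a set \<Rightarrow> real) \<Rightarrow> ereal" where
  "extend_penalty K \<psi> Q = (if Q \<in> K then \<psi> Q else \<infinity>)"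

definition convex_content_set :: "'a measure \<Rightarrow> ('a set \<Rightarrow> real) set \<Rightarrow> bool" where
  "convex_content_set M K \<longleftrightarrow>
    (\<forall>Q\<in>K. \<forall>R\<in>K. \<forall>t\<in>{0..1}. (\<lambda>A\<in>sets M. t * Q A + (1 - t) * R A) \<in> K)"


section \<open>The space $L^1$, densities and lower semicontinuity\<close>

text \<open>Elements of $L^1$ and $L^\infty$ are represented by functions rather than by classes of almost
  everywhere equal functions. The topologies below are those of the seminorm and of the pairing, so
  every open or closed set is a union of such classes.\<close>

definition L1_space :: "'a measure \<Rightarrow> ('a \<Rightarrow> real) set" where
  "L1_space M = {f. integrable M f}"

definition Linf_space :: "'a measure \<Rightarrow> ('a \<Rightarrow> real) set" where
  "Linf_space M = {g \<in> borel_measurable M. \<exists>C. AE x in M. \<bar>g x\<bar> \<le> C}"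

definition L1_strong_topology :: "'a measure \<Rightarrow> ('a \<Rightarrow> real) topology" where
  "L1_strong_topology M = topology_generated_by
    {{g \<in> L1_space M. (\<integral>x. \<bar>g x - f x\<bar> \<partial>M) < e} |f e. f \<in> L1_space M \<and> e > 0}"

definition L1_weak_topology :: "'a measure \<Rightarrow> ('a \<Rightarrow> real) topology" where
  "L1_weak_topology M = topology_generated_by
    {{f \<in> L1_space M. (\<integral>x. f x * g x \<partial>M) \<in> V} |g V. g \<in> Linf_space M \<and> open V}"

text \<open>$D$ is a version of $d\mathbb{Q}/d\mathbb{P}$ iff $D$ is in $L^1$ and $\mathbb{Q}$ is
  \<open>content_of_density\<close> of $D$.\<close>

definition content_of_density :: "'a measure \<Rightarrow> ('a \<Rightarrow> real) \<Rightarrow> 'a set \<Rightarrow> real" where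
  "content_of_density M D = (\<lambda>A\<in>sets M. LINT x:A|M. D x)"

definition densities :: "'a measure \<Rightarrow> ('a set \<Rightarrow> real) set \<Rightarrow> ('a \<Rightarrow> real) set" where
  "densities M K = {D \<in> L1_space M. content_of_density M D \<in> K}"

definition density_penalty ::
    "'a measure \<Rightarrow> ('a set \<Rightarrow> real) set \<Rightarrow> (('a set \<Rightarrow> real) \<Rightarrow> ereal) \<Rightarrow> ('a \<Rightarrow> real) \<Rightarrow> ereal" where
  "density_penalty M K \<psi> D =
    (if D \<in> densities M K then \<psi> (content_of_density M D) else \<infinity>)"

definition lsc_wrt :: "'b topology \<Rightarrow> ('b \<Rightarrow> ereal) \<Rightarrow> bool" where
  "lsc_wrt T F \<longleftrightarrow> (\<forall>a. openin T {f \<in> topspace T. a < F f})"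

definition proper_on_L1 :: "'a measure \<Rightarrow> (('a \<Rightarrow> real) \<Rightarrow> ereal) \<Rightarrow> bool" where
  "proper_on_L1 M F \<longleftrightarrow> (\<forall>D\<in>L1_space M. F D \<noteq> -\<infinity>) \<and> (\<exists>D\<in>L1_space M. F D \<noteq> \<infinity>)"

definition convex_on_L1 :: "'a measure \<Rightarrow> (('a \<Rightarrow> real) \<Rightarrow> ereal) \<Rightarrow> bool" where
  "convex_on_L1 M F \<longleftrightarrow>
    (\<forall>D\<in>L1_space M. \<forall>E\<in>L1_space M. \<forall>t\<in>{0..1}.
       F (\<lambda>x. t * D x + (1 - t) * E x) \<le> ereal t * F D + ereal (1 - t) * F E)"


section \<open>Basic facts on the integral with respect to a content\<close>

lemma prob_content_sum:
  assumes Q: "Q \<in> prob_contents M" and "finite I"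
    and "\<And>i. i \<in> I \<Longrightarrow> A i \<in> sets M" and "disjoint_family_on A I"
  shows "Q (\<Union>i\<in>I. A i) = (\<Sum>i\<in>I. Q (A i))"
  using assms(2-)
proof (induction I)
  case empty
  have "Q ({} \<union> {}) = Q {} + Q {}"
    using Q by (intro additiveD[of "sets M"]) (auto simp: prob_contents_def)
  then show ?case by simp
next
  case (insert i I)
  have "A i \<inter> (\<Union>j\<in>I. A j) = {}"
    using insert.hyps insert.prems(2) by (auto simp: disjoint_family_on_def)
  then have "Q (A i \<union> (\<Union>j\<in>I. A j)) = Q (A i) + Q (\<Union>j\<in>I. A j)"
    using Q insert by (intro additiveD[of "sets M"]) (auto simp: prob_contents_def)
  moreover have "Q (\<Union>j\<in>I. A j) = (\<Sum>j\<in>I. Q (A j))"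
    using insert by (intro insert.IH) (auto intro: disjoint_family_on_mono)
  ultimately show ?case using insert.hyps by simp
qed

lemma simple_content_integral_compose:
  assumes Q: "Q \<in> prob_contents M" and p: "simple_function M p"
  shows "simple_content_integral M Q (\<lambda>x. h (p x))
    = (\<Sum>z\<in>p ` space M. h z * Q (p -` {z} \<inter> space M))"
proof -
  let ?P = "p ` space M"
  have fin: "finite ?P" using p by (rule simple_functionD)
  have eq: "Q ((\<lambda>x. h (p x)) -` {y} \<inter> space M)
      = (\<Sum>z | z \<in> ?P \<and> h z = y. Q (p -` {z} \<inter> space M))" for y
  proof -
    have "(\<lambda>x. h (p x)) -` {y} \<inter> space M = (\<Union>z\<in>{z \<in> ?P. h z = y}. p -` {z} \<inter> space M)"
      by auto
    also have "Q \<dots> = (\<Sum>z | z \<in> ?P \<and> h z = y. Q (p -` {z} \<inter> space M))"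
      using fin p
      by (intro prob_content_sum[OF Q]) (auto simp: disjoint_family_on_def simple_function_def)
    finally show ?thesis .
  qed
  have "simple_content_integral M Q (\<lambda>x. h (p x))
     = (\<Sum>y\<in>h ` ?P. \<Sum>z | z \<in> ?P \<and> h z = y. h z * Q (p -` {z} \<inter> space M))"
    unfolding simple_content_integral_def
    by (intro sum.cong) (auto simp: eq sum_distrib_left)
  also have "\<dots> = (\<Sum>z\<in>?P. h z * Q (p -` {z} \<inter> space M))"
    by (rule sum.image_gen[OF fin, symmetric])
  finally show ?thesis .
qed

lemma
  assumes Q: "Q \<in> prob_contents M" and s: "simple_function M s" and t: "simple_function M t"
  shows simple_content_integral_lincomb:
      "simple_content_integral M Q (\<lambda>x. a * s x + b * t x)
        = a * simple_content_integral M Q s + b * simple_content_integral M Q t"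
    and simple_content_integral_mono:
      "(\<And>x. x \<in> space M \<Longrightarrow> s x \<le> t x)
        \<Longrightarrow> simple_content_integral M Q s \<le> simple_content_integral M Q t"
proof -
  let ?p = "\<lambda>x. (s x, t x)"
  have p: "simple_function M ?p" using s t by simp
  have nn: "0 \<le> Q (?p -` {z} \<inter> space M)" if "z \<in> ?p ` space M" for z
    using Q p that by (fastforce simp: prob_contents_def simple_function_def PiE_def Pi_def)
  note rep = simple_content_integral_compose[OF Q p]
  show "simple_content_integral M Q (\<lambda>x. a * s x + b * t x)
        = a * simple_content_integral M Q s + b * simple_content_integral M Q t"
    using rep[of "\<lambda>z. a * fst z + b * snd z"] rep[of fst] rep[of snd]
    by (simp add: sum_distrib_left sum.distrib algebra_simps)
  show "simple_content_integral M Q s \<le> simple_content_integral M Q t"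
    if le: "\<And>x. x \<in> space M \<Longrightarrow> s x \<le> t x"
  proof -
    have "(\<Sum>z\<in>?p ` space M. fst z * Q (?p -` {z} \<inter> space M))
        \<le> (\<Sum>z\<in>?p ` space M. snd z * Q (?p -` {z} \<inter> space M))"
    proof (rule sum_mono)
      fix z assume z: "z \<in> ?p ` space M"
      then have "fst z \<le> snd z" using le by auto
      then show "fst z * Q (?p -` {z} \<inter> space M) \<le> snd z * Q (?p -` {z} \<inter> space M)"
        using nn[OF z] by (rule mult_right_mono)
    qed
    then show ?thesis using rep[of fst] rep[of snd] by simp
  qed
qed

lemma simple_content_integral_const:
  assumes Q: "Q \<in> prob_contents M"
  shows "simple_content_integral M Q (\<lambda>x. c) = c"
proof (cases "space M = {}")
  case True
  have "Q {} = Q {} + Q {}"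
    using Q additiveD[of "sets M" Q "{}" "{}"] by (auto simp: prob_contents_def)
  then show ?thesis using True Q by (simp add: prob_contents_def)
next
  case False
  then have "(\<lambda>x. c) ` space M = {c}" "(\<lambda>x. c) -` {c} \<inter> space M = space M" by auto
  then show ?thesis using Q by (simp add: simple_content_integral_def prob_contents_def)
qed

lemma content_integral_approx:
  assumes Q: "Q \<in> prob_contents M" and s: "simple_function M s"
    and le: "\<And>x. x \<in> space M \<Longrightarrow> s x \<le> X x" and ge: "\<And>x. x \<in> space M \<Longrightarrow> X x \<le> s x + e"
  shows "simple_content_integral M Q s \<le> content_integral M Q X"
    and "content_integral M Q X \<le> simple_content_integral M Q s + e"
proof -
  let ?S = "{simple_content_integral M Q s |s. simple_function M s \<and> (\<forall>x\<in>space M. s x \<le> X x)}"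
  have mem: "simple_content_integral M Q s \<in> ?S" using s le by blast
  have bnd: "y \<le> simple_content_integral M Q s + e" if "y \<in> ?S" for y
  proof -
    from that obtain t where t: "simple_function M t" "\<forall>x\<in>space M. t x \<le> X x"
      "y = simple_content_integral M Q t" by blast
    have "y \<le> simple_content_integral M Q (\<lambda>x. 1 * s x + 1 * e)"
      unfolding t(3) using s t ge
      by (intro simple_content_integral_mono[OF Q]) (auto intro: order_trans)
    also have "\<dots> = simple_content_integral M Q s + e"
      using simple_content_integral_lincomb[OF Q s, of "\<lambda>x. e" 1 1]
      by (simp add: simple_content_integral_const[OF Q])
    finally show ?thesis .
  qed
  show "simple_content_integral M Q s \<le> content_integral M Q X"
    unfolding content_integral_def using mem bnd by (intro cSup_upper) (auto simp: bdd_above_def)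
  show "content_integral M Q X \<le> simple_content_integral M Q s + e"
    unfolding content_integral_def using mem bnd by (intro cSup_least) blast+
qed

lemma simple_approx_uniform:
  assumes X: "X \<in> bounded_measurable M" and e: "(0::real) < e"
  obtains s where "simple_function M s"
    "\<And>x. x \<in> space M \<Longrightarrow> s x \<le> X x" "\<And>x. x \<in> space M \<Longrightarrow> X x \<le> s x + e"
proof
  let ?s = "\<lambda>x. e * of_int \<lfloor>X x / e\<rfloor>"
  from X obtain C where C: "\<And>x. x \<in> space M \<Longrightarrow> \<bar>X x\<bar> \<le> C" and meas: "X \<in> borel_measurable M"
    by (auto simp: bounded_measurable_def)
  have "?s ` space M \<subseteq> (\<lambda>k. e * of_int k) ` {\<lfloor>- C / e\<rfloor>..\<lfloor>C / e\<rfloor>}"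
  proof safe
    fix x assume "x \<in> space M"
    then have "- C \<le> X x" "X x \<le> C" using C[of x] by auto
    then have "\<lfloor>X x / e\<rfloor> \<in> {\<lfloor>- C / e\<rfloor>..\<lfloor>C / e\<rfloor>}"
      using e by (auto intro!: floor_mono divide_right_mono simp del: minus_divide_left divide_minus_left)
    then show "?s x \<in> (\<lambda>k. e * of_int k) ` {\<lfloor>- C / e\<rfloor>..\<lfloor>C / e\<rfloor>}" by blast
  qed
  then have "finite (?s ` space M)" by (rule finite_subset) simp
  moreover have "?s \<in> borel_measurable M" using meas by measurable
  ultimately show "simple_function M ?s" by (intro simple_function_borel_measurable)
  show "?s x \<le> X x" for x
    using e of_int_floor_le[of "X x / e"] by (simp only: pos_le_divide_eq mult.commute)
  show "X x \<le> ?s x + e" for x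
    using e real_of_int_floor_add_one_ge[of "X x / e"] by (simp add: field_simps)
qed

lemma bounded_measurable_lincomb:
  assumes "X \<in> bounded_measurable M" "Y \<in> bounded_measurable M"
  shows "(\<lambda>x. a * X x + b * Y x) \<in> bounded_measurable M"
proof -
  from assms obtain C D where "\<And>x. x \<in> space M \<Longrightarrow> \<bar>X x\<bar> \<le> C" "\<And>x. x \<in> space M \<Longrightarrow> \<bar>Y x\<bar> \<le> D"
    by (auto simp: bounded_measurable_def)
  then have "\<bar>a * X x + b * Y x\<bar> \<le> \<bar>a\<bar> * C + \<bar>b\<bar> * D" if "x \<in> space M" for x
    using that by (intro order_trans[OF abs_triangle_ineq] add_mono)
      (auto simp: abs_mult mult_left_mono)
  then show ?thesis using assms by (auto simp: bounded_measurable_def)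
qed

lemma bounded_measurable_const: "(\<lambda>x. c) \<in> bounded_measurable M"
  by (auto simp: bounded_measurable_def)

lemma bounded_measurable_uminus:
  "X \<in> bounded_measurable M \<Longrightarrow> (\<lambda>x. - X x) \<in> bounded_measurable M"
  using bounded_measurable_lincomb[of X M X "-1" 0] by simp

lemma content_integral_const: "Q \<in> prob_contents M \<Longrightarrow> content_integral M Q (\<lambda>x. c) = c"
  using content_integral_approx[of Q M "\<lambda>x. c" "\<lambda>x. c" 0] simple_content_integral_const[of Q M c]
  by simp

lemma content_integral_mono:
  assumes Q: "Q \<in> prob_contents M" and X: "X \<in> bounded_measurable M" and Y: "Y \<in> bounded_measurable M"
    and le: "\<And>x. x \<in> space M \<Longrightarrow> X x \<le> Y x"
  shows "content_integral M Q X \<le> content_integral M Q Y"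
proof (rule field_le_epsilon)
  fix e :: real assume e: "0 < e"
  obtain s where s: "simple_function M s"
    "\<And>x. x \<in> space M \<Longrightarrow> s x \<le> X x" "\<And>x. x \<in> space M \<Longrightarrow> X x \<le> s x + e"
    using simple_approx_uniform[OF X e] by blast
  obtain t where t: "simple_function M t"
    "\<And>x. x \<in> space M \<Longrightarrow> t x \<le> Y x" "\<And>x. x \<in> space M \<Longrightarrow> Y x \<le> t x + e"
    using simple_approx_uniform[OF Y e] by blast
  let ?u = "\<lambda>x. max (s x) (t x)"
  have u: "simple_function M ?u" using s t by simp
  have "content_integral M Q X \<le> simple_content_integral M Q s + e"
    by (rule content_integral_approx[OF Q s])
  also have "simple_content_integral M Q s \<le> simple_content_integral M Q ?u"
    using s t by (intro simple_content_integral_mono[OF Q]) auto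
  also have "simple_content_integral M Q ?u \<le> content_integral M Q Y"
    by (rule content_integral_approx[OF Q u, of Y e]) (use s t le in \<open>force intro: order_trans\<close>)+
  finally show "content_integral M Q X \<le> content_integral M Q Y + e" by simp
qed

lemma content_integral_lincomb_nonneg:
  assumes Q: "Q \<in> prob_contents M" and X: "X \<in> bounded_measurable M" and Y: "Y \<in> bounded_measurable M"
    and a: "0 \<le> a" and b: "0 \<le> b"
  shows "content_integral M Q (\<lambda>x. a * X x + b * Y x)
    = a * content_integral M Q X + b * content_integral M Q Y"
proof -
  let ?E = "content_integral M Q" and ?S = "simple_content_integral M Q"
  have "\<bar>?E (\<lambda>x. a * X x + b * Y x) - (a * ?E X + b * ?E Y)\<bar> \<le> (a + b) * e" if e: "0 < e" for e
  proof -
    obtain s where s: "simple_function M s"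
      "\<And>x. x \<in> space M \<Longrightarrow> s x \<le> X x" "\<And>x. x \<in> space M \<Longrightarrow> X x \<le> s x + e"
      using simple_approx_uniform[OF X e] by blast
    obtain t where t: "simple_function M t"
      "\<And>x. x \<in> space M \<Longrightarrow> t x \<le> Y x" "\<And>x. x \<in> space M \<Longrightarrow> Y x \<le> t x + e"
      using simple_approx_uniform[OF Y e] by blast
    let ?u = "\<lambda>x. a * s x + b * t x"
    have u: "simple_function M ?u" using s t by auto
    have lo: "?u x \<le> a * X x + b * Y x" if "x \<in> space M" for x
      using s(2) t(2) a b that by (intro add_mono mult_left_mono) auto
    have hi: "a * X x + b * Y x \<le> ?u x + (a + b) * e" if "x \<in> space M" for x
    proof -
      have "a * X x + b * Y x \<le> a * (s x + e) + b * (t x + e)"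
        using s(3) t(3) a b that by (intro add_mono mult_left_mono) auto
      then show ?thesis by (simp add: algebra_simps)
    qed
    have Su: "?S ?u = a * ?S s + b * ?S t"
      by (rule simple_content_integral_lincomb[OF Q s(1) t(1)])
    have 1: "?S ?u \<le> ?E (\<lambda>x. a * X x + b * Y x)"
      "?E (\<lambda>x. a * X x + b * Y x) \<le> ?S ?u + (a + b) * e"
      using content_integral_approx[OF Q u lo hi] by auto
    have "?S s \<le> ?E X" "?E X \<le> ?S s + e" "?S t \<le> ?E Y" "?E Y \<le> ?S t + e"
      using content_integral_approx[OF Q s] content_integral_approx[OF Q t] by auto
    then have "a * ?S s \<le> a * ?E X" "a * ?E X \<le> a * (?S s + e)"
      "b * ?S t \<le> b * ?E Y" "b * ?E Y \<le> b * (?S t + e)"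
      using a b by (auto intro: mult_left_mono)
    with 1 Su show ?thesis by (simp add: algebra_simps abs_le_iff)
  qed
  note close = this
  have "\<bar>?E (\<lambda>x. a * X x + b * Y x) - (a * ?E X + b * ?E Y)\<bar> \<le> 0"
  proof (rule field_le_epsilon)
    fix d :: real assume d: "0 < d"
    have "(a + b) * (d / (a + b + 1)) \<le> d"
      using a b d by (simp add: field_simps)
    then show "\<bar>?E (\<lambda>x. a * X x + b * Y x) - (a * ?E X + b * ?E Y)\<bar> \<le> 0 + d"
      using close[of "d / (a + b + 1)"] a b d by simp
  qed
  then show ?thesis by simp
qed

text \<open>For a measure, the integral of a content is the usual expectation.\<close>

lemma content_integral_eq_expectation:
  assumes N: "prob_space N" "sets N = sets M" and X: "X \<in> bounded_measurable M"
  shows "content_integral M (restrict (measure N) (sets M)) X = (\<integral>x. X x \<partial>N)"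
proof -
  interpret prob_space N by (rule N)
  let ?Q = "restrict (measure N) (sets M)"
  have sp: "space N = space M" using N(2) by (rule sets_eq_imp_space_eq)
  have Q: "?Q \<in> prob_contents M"
    using N(2) sp prob_space by (auto simp: prob_contents_def additive_def finite_measure_Union)
  have simple: "simple_content_integral M ?Q s = (\<integral>x. s x \<partial>N)" and intg: "integrable N s"
    if s: "simple_function M s" for s
  proof -
    have meas: "s -` {y} \<inter> space M \<in> sets N" if "y \<in> s ` space M" for y
      using s that N(2) by (auto simp: simple_function_def)
    have fin: "finite (s ` space M)" using s by (rule simple_functionD)
    have rep: "s x = (\<Sum>y\<in>s ` space M. y * indicator (s -` {y} \<inter> space M) x)"
      if x: "x \<in> space N" for x
    proof -
      have "(\<Sum>y\<in>s ` space M. y * indicator (s -` {y} \<inter> space M) x)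
          = (\<Sum>y\<in>s ` space M. if y = s x then y else 0)"
        using x by (intro sum.cong) (auto simp: sp)
      also have "\<dots> = s x" using x fin by (simp add: sp)
      finally show ?thesis by simp
    qed
    have int: "integrable N (\<lambda>x. y * indicator (s -` {y} \<inter> space M) x :: real)"
      if "y \<in> s ` space M" for y
      using meas[OF that] by (intro integrable_mult_right) (simp add: emeasure_eq_measure)
    show "integrable N s"
      by (subst Bochner_Integration.integrable_cong[OF refl rep]) (assumption | rule Bochner_Integration.integrable_sum int)+
    have "(\<integral>x. s x \<partial>N) = (\<integral>x. (\<Sum>y\<in>s ` space M. y * indicator (s -` {y} \<inter> space M) x) \<partial>N)"
      by (rule Bochner_Integration.integral_cong[OF refl rep])
    also have "\<dots> = (\<Sum>y\<in>s ` space M. y * measure N (s -` {y} \<inter> space M))"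
      using int meas by (simp add: sp)
    finally show "simple_content_integral M ?Q s = (\<integral>x. s x \<partial>N)"
      using meas N(2) by (auto simp: simple_content_integral_def intro!: sum.cong)
  qed
  from X obtain C where "\<And>x. x \<in> space M \<Longrightarrow> \<bar>X x\<bar> \<le> C" "X \<in> borel_measurable N"
    using N(2) by (auto simp: bounded_measurable_def cong: measurable_cong_sets)
  then have intX: "integrable N X" by (intro integrable_const_bound[of _ C]) (auto simp: sp)
  have "\<bar>content_integral M ?Q X - (\<integral>x. X x \<partial>N)\<bar> \<le> 0"
  proof (rule field_le_epsilon)
    fix e :: real assume e: "0 < e"
    obtain s where s: "simple_function M s"
      "\<And>x. x \<in> space M \<Longrightarrow> s x \<le> X x" "\<And>x. x \<in> space M \<Longrightarrow> X x \<le> s x + e"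
      using simple_approx_uniform[OF X e] by blast
    have "(\<integral>x. s x \<partial>N) \<le> (\<integral>x. X x \<partial>N)"
      using intX intg[OF s(1)] s(2) by (intro integral_mono) (auto simp: sp)
    moreover have "(\<integral>x. X x \<partial>N) \<le> (\<integral>x. s x + e \<partial>N)"
      using intX intg[OF s(1)] s(3) by (intro integral_mono) (auto simp: sp)
    moreover have "(\<integral>x. s x + e \<partial>N) = (\<integral>x. s x \<partial>N) + e"
      using intg[OF s(1)] by (simp add: prob_space)
    ultimately show "\<bar>content_integral M ?Q X - (\<integral>x. X x \<partial>N)\<bar> \<le> 0 + e"
      using content_integral_approx[OF Q s] simple[OF s(1)] by linarith
  qed
  then show ?thesis by simp
qed


section \<open>The associated functional is a convex risk measure\<close>

lemma INF_extend_penalty: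
  assumes "K \<subseteq> prob_contents M"
  shows "(INF Q\<in>prob_contents M. extend_penalty K \<psi> Q) = (INF Q\<in>K. \<psi> Q)"
proof (rule antisym)
  show "(INF Q\<in>prob_contents M. extend_penalty K \<psi> Q) \<le> (INF Q\<in>K. \<psi> Q)"
    using assms by (intro INF_mono) (auto simp: extend_penalty_def)
  show "(INF Q\<in>K. \<psi> Q) \<le> (INF Q\<in>prob_contents M. extend_penalty K \<psi> Q)"
    by (intro INF_greatest) (auto simp: extend_penalty_def intro: INF_lower)
qed

lemma ac_prob_measures_subset: "ac_prob_measures M \<subseteq> prob_contents M"
proof
  fix Q assume "Q \<in> ac_prob_measures M"
  then obtain N where N: "prob_space N" "sets N = sets M" and Q: "Q = restrict (measure N) (sets M)"
    by (auto simp: ac_prob_measures_def)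
  interpret prob_space N by (rule N)
  have "space N = space M" using N(2) by (rule sets_eq_imp_space_eq)
  then show "Q \<in> prob_contents M"
    using N(2) prob_space by (auto simp: Q prob_contents_def additive_def finite_measure_Union)
qed

lemma risk_measure_of_eq_SUP:
  assumes fin: "\<bar>INF Q\<in>prob_contents M. \<phi> Q\<bar> \<noteq> \<infinity>" and X: "X \<in> bounded_measurable M"
  shows "ereal (risk_measure_of M \<phi> X)
    = (SUP Q\<in>prob_contents M. ereal (content_integral M Q (\<lambda>x. - X x)) - \<phi> Q)"
proof -
  let ?V = "SUP Q\<in>prob_contents M. ereal (content_integral M Q (\<lambda>x. - X x)) - \<phi> Q"
  from fin obtain c where c: "(INF Q\<in>prob_contents M. \<phi> Q) = ereal c" by auto
  have lb: "ereal c \<le> \<phi> Q" if "Q \<in> prob_contents M" for Q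
    using that by (simp add: c[symmetric] INF_lower)
  from X obtain C where C: "\<And>x. x \<in> space M \<Longrightarrow> \<bar>X x\<bar> \<le> C"
    by (auto simp: bounded_measurable_def)
  have "content_integral M Q (\<lambda>x. - X x) \<le> C" if Q: "Q \<in> prob_contents M" for Q
    using content_integral_mono[OF Q bounded_measurable_uminus[OF X] bounded_measurable_const[of C]] C
    by (force simp: content_integral_const[OF Q] abs_le_iff)
  then have "?V \<le> ereal C - ereal c"
    using lb by (intro SUP_least ereal_minus_mono) auto
  then have up: "?V \<noteq> \<infinity>" by auto
  have "\<not> (\<forall>Q\<in>prob_contents M. \<phi> Q = \<infinity>)"
  proof
    assume "\<forall>Q\<in>prob_contents M. \<phi> Q = \<infinity>"
    then have "(\<infinity>::ereal) \<le> (INF Q\<in>prob_contents M. \<phi> Q)" by (intro INF_greatest) simp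
    then show False using c by simp
  qed
  then obtain Q where Q: "Q \<in> prob_contents M" "\<phi> Q \<noteq> \<infinity>" by blast
  then obtain r where r: "\<phi> Q = ereal r" using lb[of Q] by (cases "\<phi> Q") auto
  have "ereal (content_integral M Q (\<lambda>x. - X x)) - \<phi> Q \<le> ?V"
    using Q by (intro SUP_upper)
  then have "?V \<noteq> -\<infinity>" using r by auto
  with up show ?thesis by (auto simp: risk_measure_of_def ereal_real)
qed

lemma risk_measure_of_upper:
  assumes fin: "\<bar>INF Q\<in>prob_contents M. \<phi> Q\<bar> \<noteq> \<infinity>" and X: "X \<in> bounded_measurable M"
    and Q: "Q \<in> prob_contents M" "\<phi> Q = ereal r"
  shows "content_integral M Q (\<lambda>x. - X x) - r \<le> risk_measure_of M \<phi> X"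
proof -
  have "ereal (content_integral M Q (\<lambda>x. - X x)) - \<phi> Q \<le> ereal (risk_measure_of M \<phi> X)"
    unfolding risk_measure_of_eq_SUP[OF fin X] using Q by (intro SUP_upper)
  then show ?thesis by (simp add: Q)
qed

lemma risk_measure_of_least:
  assumes fin: "\<bar>INF Q\<in>prob_contents M. \<phi> Q\<bar> \<noteq> \<infinity>" and X: "X \<in> bounded_measurable M"
    and le: "\<And>Q r. Q \<in> prob_contents M \<Longrightarrow> \<phi> Q = ereal r
      \<Longrightarrow> content_integral M Q (\<lambda>x. - X x) - r \<le> b"
  shows "risk_measure_of M \<phi> X \<le> b"
proof -
  have "ereal (content_integral M Q (\<lambda>x. - X x)) - \<phi> Q \<le> ereal b" if Q: "Q \<in> prob_contents M" for Q
  proof (cases "\<phi> Q")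
    case (real r)
    then show ?thesis using le[OF Q] by simp
  next
    case MInf
    then have "(INF Q\<in>prob_contents M. \<phi> Q) \<le> -\<infinity>" using Q by (metis INF_lower)
    then show ?thesis using fin by simp
  qed simp
  then have "ereal (risk_measure_of M \<phi> X) \<le> ereal b"
    unfolding risk_measure_of_eq_SUP[OF fin X] by (rule SUP_least)
  then show ?thesis by simp
qed

lemma convex_risk_measure_risk_measure_of:
  assumes fin: "\<bar>INF Q\<in>prob_contents M. \<phi> Q\<bar> \<noteq> \<infinity>"
  shows "convex_risk_measure M (risk_measure_of M \<phi>)"
proof -
  let ?\<rho> = "risk_measure_of M \<phi>" and ?B = "bounded_measurable M"
  have mono: "?\<rho> Y \<le> ?\<rho> X" if X: "X \<in> ?B" and Y: "Y \<in> ?B" and le: "\<forall>x\<in>space M. X x \<le> Y x" for X Y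
  proof (rule risk_measure_of_least[OF fin Y])
    fix Q r assume Q: "Q \<in> prob_contents M" "\<phi> Q = ereal r"
    have "content_integral M Q (\<lambda>x. - Y x) \<le> content_integral M Q (\<lambda>x. - X x)"
      using le by (intro content_integral_mono[OF Q(1)] bounded_measurable_uminus X Y) auto
    then show "content_integral M Q (\<lambda>x. - Y x) - r \<le> ?\<rho> X"
      using risk_measure_of_upper[where \<phi>=\<phi>, OF fin X Q] by linarith
  qed
  have trans_le: "?\<rho> (\<lambda>x. X x + a) \<le> ?\<rho> X - a" if X: "X \<in> ?B" for X a
  proof (rule risk_measure_of_least[OF fin])
    show "(\<lambda>x. X x + a) \<in> ?B"
      using bounded_measurable_lincomb[OF X bounded_measurable_const[of a], of 1 1] by simp
    fix Q r assume Q: "Q \<in> prob_contents M" "\<phi> Q = ereal r"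
    have "content_integral M Q (\<lambda>x. - (X x + a)) = content_integral M Q (\<lambda>x. - X x) - a"
      using content_integral_lincomb_nonneg[OF Q(1) bounded_measurable_uminus[OF X]
          bounded_measurable_const[of "- a"], of 1 1]
      by (simp add: content_integral_const[OF Q(1)])
    then show "content_integral M Q (\<lambda>x. - (X x + a)) - r \<le> ?\<rho> X - a"
      using risk_measure_of_upper[where \<phi>=\<phi>, OF fin X Q] by linarith
  qed
  have trans: "?\<rho> (\<lambda>x. X x + a) = ?\<rho> X - a" if X: "X \<in> ?B" for X a
  proof (rule antisym)
    have "(\<lambda>x. X x + a) \<in> ?B"
      using bounded_measurable_lincomb[OF X bounded_measurable_const[of a], of 1 1] by simp
    from trans_le[OF this, of "- a"] show "?\<rho> X - a \<le> ?\<rho> (\<lambda>x. X x + a)" by simp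
  qed (rule trans_le[OF X])
  have conv: "?\<rho> (\<lambda>x. t * X x + (1 - t) * Y x) \<le> t * ?\<rho> X + (1 - t) * ?\<rho> Y"
    if X: "X \<in> ?B" and Y: "Y \<in> ?B" and t: "t \<in> {0..1}" for X Y t
  proof (rule risk_measure_of_least[OF fin bounded_measurable_lincomb[OF X Y]])
    fix Q r assume Q: "Q \<in> prob_contents M" "\<phi> Q = ereal r"
    let ?E = "content_integral M Q"
    have "?E (\<lambda>x. - (t * X x + (1 - t) * Y x)) = t * ?E (\<lambda>x. - X x) + (1 - t) * ?E (\<lambda>x. - Y x)"
      using content_integral_lincomb_nonneg[OF Q(1) bounded_measurable_uminus[OF X]
          bounded_measurable_uminus[OF Y], of t "1 - t"] t
      by simp
    also have "\<dots> - r = t * (?E (\<lambda>x. - X x) - r) + (1 - t) * (?E (\<lambda>x. - Y x) - r)"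
      by (simp add: algebra_simps)
    also have "\<dots> \<le> t * ?\<rho> X + (1 - t) * ?\<rho> Y"
      using t risk_measure_of_upper[where \<phi>=\<phi>, OF fin X Q] risk_measure_of_upper[where \<phi>=\<phi>, OF fin Y Q]
      by (intro add_mono mult_left_mono) auto
    finally show "?E (\<lambda>x. - (t * X x + (1 - t) * Y x)) - r \<le> t * ?\<rho> X + (1 - t) * ?\<rho> Y" .
  qed
  show ?thesis
    unfolding convex_risk_measure_def using mono trans conv by blast
qed

end

theory Submission
  imports Defs "HOL-Library.Function_Algebras"
begin

text \<open>If the penalty is minimal, its density version is on the closed set of densities a supremum of
  continuous linear functionals, which gives (a). For (b) and for the passage from the strong to the
  weak topology one needs, for \<open>a < \<Psi> D\<close>, a bounded \<open>g\<close> with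
  \<open>a + \<integral> (f - D) g \<le> \<Psi> f\<close> for all \<open>f\<close>. As \<open>\<Psi>\<close> is bounded below, lower semicontinuity at
  \<open>D\<close> gives \<open>\<Psi> f \<ge> a - L \<parallel>f - D\<parallel>\<close>, and the Hahn--Banach sandwich theorem separates the convex
  \<open>\<Psi>\<close> from this concave function by an affine functional whose linear part has norm at most \<open>L\<close>
  and is therefore represented by a bounded function. So no vertical separating
  hyperplane has to be treated, not even when \<open>\<Psi> D = \<infinity>\<close>. The position
  \<open>X = b - g\<close> with \<open>b = \<integral> D g - a\<close> is then acceptable and shows that the minimal penalty is at
  least \<open>a\<close>.\<close>

section \<open>Sublinear functionals and the Hahn--Banach theorem\<close>

text \<open>Relative to a set because \<open>L1_space M\<close> is only a subspace of the type of
  all real functions, on which the integral need not be additive.\<close>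

definition sublinear_on :: "'v::real_vector set \<Rightarrow> ('v \<Rightarrow> real) \<Rightarrow> bool" where
  "sublinear_on S p \<longleftrightarrow> (\<forall>x\<in>S. \<forall>y\<in>S. p (x + y) \<le> p x + p y) \<and>
    (\<forall>x\<in>S. \<forall>c\<ge>0. p (c *\<^sub>R x) = c * p x)"

definition linear_functional_on :: "'v::real_vector set \<Rightarrow> ('v \<Rightarrow> real) \<Rightarrow> bool" where
  "linear_functional_on S l \<longleftrightarrow> (\<forall>x\<in>S. \<forall>y\<in>S. l (x + y) = l x + l y) \<and>
    (\<forall>x\<in>S. \<forall>c. l (c *\<^sub>R x) = c * l x)"

lemma sublinear_on_add:
  "sublinear_on S p \<Longrightarrow> x \<in> S \<Longrightarrow> y \<in> S \<Longrightarrow> p (x + y) \<le> p x + p y"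
  and sublinear_on_scale:
  "sublinear_on S p \<Longrightarrow> x \<in> S \<Longrightarrow> 0 \<le> c \<Longrightarrow> p (c *\<^sub>R x) = c * p x"
  by (auto simp: sublinear_on_def)

lemma sublinear_on_zero: "sublinear_on S p \<Longrightarrow> subspace S \<Longrightarrow> p 0 = 0"
  using sublinear_on_scale[of S p 0 0] by (simp add: subspace_0)

lemma sublinear_on_uminus_le:
  assumes "sublinear_on S p" "subspace S" "x \<in> S"
  shows "- p (- x) \<le> p x"
  using sublinear_on_add[OF assms(1) assms(3) subspace_neg[OF assms(2,3)]]
    sublinear_on_zero[OF assms(1,2)] by simp

lemma sublinear_on_cong:
  assumes "subspace S" "\<And>x. x \<in> S \<Longrightarrow> p x = q x"
  shows "sublinear_on S p \<longleftrightarrow> sublinear_on S q"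
  using assms by (auto simp: sublinear_on_def subspace_add subspace_scale)

text \<open>The infimum absorbs the passage to another index in \<open>add\<close> and
  \<open>scale\<close>, so the single members need not be sublinear. The bound \<open>b\<close>
  keeps the infimum real, and the conditions at \<open>0\<close> settle the factor \<open>0\<close>,
  which \<open>scale\<close> leaves out.\<close>

lemma sublinear_on_INF:
  fixes F :: "'i \<Rightarrow> 'v::real_vector \<Rightarrow> real"
  assumes S: "subspace S" and ne: "I \<noteq> {}"
    and bdd: "\<And>i x. i \<in> I \<Longrightarrow> x \<in> S \<Longrightarrow> b x \<le> F i x"
    and zero: "\<And>i. i \<in> I \<Longrightarrow> 0 \<le> F i 0" "\<exists>i\<in>I. F i 0 \<le> 0"
    and add: "\<And>i j x y. i \<in> I \<Longrightarrow> j \<in> I \<Longrightarrow> x \<in> S \<Longrightarrow> y \<in> S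
      \<Longrightarrow> \<exists>k\<in>I. F k (x + y) \<le> F i x + F j y"
    and scale: "\<And>i c x. i \<in> I \<Longrightarrow> 0 < c \<Longrightarrow> x \<in> S \<Longrightarrow> \<exists>k\<in>I. F k (c *\<^sub>R x) \<le> c * F i x"
  shows "sublinear_on S (\<lambda>x. INF i\<in>I. F i x)"
proof -
  let ?p = "\<lambda>x. INF i\<in>I. F i x"
  have bb: "bdd_below ((\<lambda>i. F i x) ` I)" if "x \<in> S" for x
    using bdd[OF _ that] by (auto simp: bdd_below_def)
  have low: "?p x \<le> F i x" if "x \<in> S" "i \<in> I" for x i
    using bb[OF that(1)] that(2) by (rule cINF_lower)
  have "?p (x + y) \<le> ?p x + ?p y" if xy: "x \<in> S" "y \<in> S" for x y
  proof -
    have "?p (x + y) \<le> F i x + F j y" if "i \<in> I" "j \<in> I" for i j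
      using add[OF that xy] low[OF subspace_add[OF S xy]] by (metis order_trans)
    then have "?p (x + y) - F j y \<le> ?p x" if "j \<in> I" for j
      using that by (intro cINF_greatest[OF ne]) (simp add: diff_le_eq)
    then have "?p (x + y) - ?p x \<le> ?p y"
      by (intro cINF_greatest[OF ne]) (simp add: diff_le_eq add.commute)
    then show ?thesis by simp
  qed
  moreover have "?p (c *\<^sub>R x) = c * ?p x" if x: "x \<in> S" and c: "0 \<le> c" for x c
  proof (cases "c = 0")
    case True
    have "?p 0 = 0"
    proof (rule antisym)
      show "?p 0 \<le> 0" using zero(2) low[OF subspace_0[OF S]] by (metis order_trans)
      show "0 \<le> ?p 0" using zero(1) by (intro cINF_greatest[OF ne])
    qed
    then show ?thesis using True by simp
  next
    case False
    \<comment> \<open>One inequality suffices: the converse is the same inequality for the factor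
      \<open>1 / c\<close> at the point \<open>c x\<close>.\<close>
    have le: "?p (a *\<^sub>R y) \<le> a * ?p y" if a: "0 < a" and y: "y \<in> S" for a y
    proof -
      have "?p (a *\<^sub>R y) / a \<le> ?p y"
      proof (rule cINF_greatest[OF ne])
        fix i assume "i \<in> I"
        then have "?p (a *\<^sub>R y) \<le> a * F i y"
          using scale[OF _ a y] low[OF subspace_scale[OF S y]] by (metis order_trans)
        then show "?p (a *\<^sub>R y) / a \<le> F i y" using a by (simp add: field_simps)
      qed
      then show ?thesis using a by (simp add: field_simps)
    qed
    have "?p ((1 / c) *\<^sub>R (c *\<^sub>R x)) \<le> (1 / c) * ?p (c *\<^sub>R x)"
      using False c x by (intro le subspace_scale[OF S]) auto
    then have "c * ?p x \<le> ?p (c *\<^sub>R x)" using False c by (simp add: field_simps)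
    with le[of c x] False c x show ?thesis by simp
  qed
  ultimately show ?thesis unfolding sublinear_on_def by blast
qed

text \<open>A minimal sublinear functional \<open>m\<close> is additive because, for fixed \<open>y\<close>, the infimum over
  \<open>t \<ge> 0\<close> of \<open>m (x + t y) - t m y\<close> is again a sublinear functional of \<open>x\<close> below \<open>m\<close>.\<close>

theorem Hahn_Banach_sublinear:
  fixes p :: "'v::real_vector \<Rightarrow> real"
  assumes S: "subspace S" and p: "sublinear_on S p"
  obtains l where "linear_functional_on S l" "\<And>x. x \<in> S \<Longrightarrow> l x \<le> p x"
proof -
  \<comment> \<open>Fixing the value \<open>0\<close> outside \<open>S\<close> lets the pointwise
    order on the whole type compare values on \<open>S\<close> only.\<close>
  define A where "A = {q. sublinear_on S q \<and> (\<forall>x\<in>S. q x \<le> p x) \<and> (\<forall>x. x \<notin> S \<longrightarrow> q x = (0::real))}"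
  \<comment> \<open>The order is reversed, so that a maximal element in Zorn's lemma is a minimal
    functional.\<close>
  let ?R = "\<lambda>q r :: 'v \<Rightarrow> real. r \<le> q"
  have inA: "(\<lambda>x. if x \<in> S then q x else 0) \<in> A"
    if q: "sublinear_on S q" and le: "\<And>x. x \<in> S \<Longrightarrow> q x \<le> p x" for q
    using le q sublinear_on_cong[OF S, of "\<lambda>x. if x \<in> S then q x else 0" q] by (auto simp: A_def)
  have "\<exists>m\<in>A. \<forall>a\<in>A. ?R m a \<longrightarrow> a = m"
  proof (rule predicate_Zorn)
    show "partial_order_on A (relation_of ?R A)"
      by (rule partial_order_on_relation_ofI) auto
    fix C assume C: "C \<in> Chains (relation_of ?R A)"
    then have CA: "C \<subseteq> A" and comp: "\<And>q r. q \<in> C \<Longrightarrow> r \<in> C \<Longrightarrow> q \<le> r \<or> r \<le> q"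
      by (auto simp: Chains_def relation_of_def)
    show "\<exists>u\<in>A. \<forall>a\<in>C. u \<le> a"
    proof (cases "C = {}")
      case True
      then show ?thesis using inA[OF p] by blast
    next
      case False
      let ?u = "\<lambda>x. INF q\<in>C. q x"
      \<comment> \<open>A lower bound independent of \<open>q\<close>, so the infimum over the chain
        is real.\<close>
      have lb: "- p (- x) \<le> q x" if "q \<in> C" "x \<in> S" for q x
      proof -
        have "- q (- x) \<le> q x" "q (- x) \<le> p (- x)"
          using that CA sublinear_on_uminus_le[of S q x] S subspace_neg[OF S] by (auto simp: A_def)
        then show ?thesis by linarith
      qed
      have low: "?u x \<le> q x" if "q \<in> C" "x \<in> S" for q x
        using that lb by (intro cINF_lower) (auto simp: bdd_below_def)
      have z: "q 0 = 0" if "q \<in> C" for q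
        using that CA sublinear_on_zero[OF _ S, of q] by (auto simp: A_def)
      have "sublinear_on S ?u"
      proof (rule sublinear_on_INF[OF S False, where F = "\<lambda>q x. q x"])
        show "\<And>q x. q \<in> C \<Longrightarrow> x \<in> S \<Longrightarrow> - p (- x) \<le> q x" by (rule lb)
        show "\<exists>q\<in>C. q 0 \<le> 0" using z False by force
        show "0 \<le> q 0" if "q \<in> C" for q using z[OF that] by simp
        fix q r x y assume qr: "q \<in> C" "r \<in> C" and xy: "x \<in> S" "y \<in> S"
        have sub: "q (x + y) \<le> q x + q y" "r (x + y) \<le> r x + r y"
          using qr CA sublinear_on_add[OF _ xy] by (auto simp: A_def)
        \<comment> \<open>Of two members of the chain, the smaller one serves for the sum.\<close>
        show "\<exists>k\<in>C. k (x + y) \<le> q x + r y"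
          using comp[OF qr]
        proof
          assume "q \<le> r"
          then have "q y \<le> r y" by (simp add: le_fun_def)
          then have "q (x + y) \<le> q x + r y" using sub by linarith
          then show ?thesis using qr by blast
        next
          assume "r \<le> q"
          then have "r x \<le> q x" by (simp add: le_fun_def)
          then have "r (x + y) \<le> q x + r y" using sub by linarith
          then show ?thesis using qr by blast
        qed
      next
        fix q c x assume "q \<in> C" "0 < (c::real)" "x \<in> S"
        then show "\<exists>k\<in>C. k (c *\<^sub>R x) \<le> c * q x"
          using CA sublinear_on_scale[of S q x c] by (intro bexI[of _ q]) (auto simp: A_def)
      qed
      moreover have "?u x \<le> p x" if "x \<in> S" for x
        using False low[OF _ that] CA that by (force simp: A_def)
      ultimately have "(\<lambda>x. if x \<in> S then ?u x else 0) \<in> A" by (rule inA)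
      moreover have "(\<lambda>x. if x \<in> S then ?u x else 0) \<le> q" if "q \<in> C" for q
        using that low CA by (auto simp: le_fun_def A_def)
      ultimately show ?thesis by blast
    qed
  qed
  then obtain m where m: "m \<in> A" and min: "\<And>a. a \<in> A \<Longrightarrow> a \<le> m \<Longrightarrow> a = m" by blast
  have ms: "sublinear_on S m" and mp: "\<And>x. x \<in> S \<Longrightarrow> m x \<le> p x"
    using m by (auto simp: A_def)
  have super: "m x + m y \<le> m (x + y)" if x: "x \<in> S" and y: "y \<in> S" for x y
  proof -
    let ?F = "\<lambda>t x. m (x + t *\<^sub>R y) - t * m y"
    let ?r = "\<lambda>x. INF t\<in>{0..}. ?F t x"
    have ty: "t *\<^sub>R y \<in> S" for t using S y by (rule subspace_scale)
    have lb: "- m (- z) \<le> ?F t z" if "t \<in> {0..}" "z \<in> S" for t z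
    proof -
      have "m ((z + t *\<^sub>R y) + (- z)) \<le> m (z + t *\<^sub>R y) + m (- z)"
        using that S ty by (intro sublinear_on_add[OF ms] subspace_add subspace_neg)
      moreover have "m (t *\<^sub>R y) = t * m y" using that y by (intro sublinear_on_scale[OF ms]) auto
      ultimately show ?thesis by simp
    qed
    have low: "?r z \<le> ?F t z" if "t \<in> {0..}" "z \<in> S" for t z
      using that lb by (intro cINF_lower) (auto simp: bdd_below_def)
    have F0: "?F t 0 = 0" if "t \<in> {0..}" for t
      using that y sublinear_on_scale[OF ms, of y t] by simp
    have "sublinear_on S ?r"
    proof (rule sublinear_on_INF[OF S, where F = ?F])
      show "\<And>t z. t \<in> {0..} \<Longrightarrow> z \<in> S \<Longrightarrow> - m (- z) \<le> ?F t z" by (rule lb)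
      show "\<And>t. t \<in> {0..} \<Longrightarrow> 0 \<le> ?F t 0" using F0 by simp
      show "\<exists>t\<in>{0..}. ?F t 0 \<le> 0" using F0 by force
    next
      fix t u v w assume tu: "t \<in> {0::real..}" "u \<in> {0::real..}" and vw: "v \<in> S" "w \<in> S"
      have "m ((v + t *\<^sub>R y) + (w + u *\<^sub>R y)) \<le> m (v + t *\<^sub>R y) + m (w + u *\<^sub>R y)"
        using vw ty S by (intro sublinear_on_add[OF ms] subspace_add)
      then have "?F (t + u) (v + w) \<le> ?F t v + ?F u w" by (simp add: algebra_simps)
      then show "\<exists>k\<in>{0..}. ?F k (v + w) \<le> ?F t v + ?F u w"
        using tu by (intro bexI[of _ "t + u"]) auto
    next
      fix t c v assume t: "t \<in> {0::real..}" and c: "0 < (c::real)" and v: "v \<in> S"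
      have "m (c *\<^sub>R (v + t *\<^sub>R y)) = c * m (v + t *\<^sub>R y)"
        using v ty S c by (intro sublinear_on_scale[OF ms] subspace_add) auto
      then have "?F (c * t) (c *\<^sub>R v) \<le> c * ?F t v" by (simp add: algebra_simps)
      then show "\<exists>k\<in>{0..}. ?F k (c *\<^sub>R v) \<le> c * ?F t v"
        using t c by (intro bexI[of _ "c * t"]) auto
    qed simp
    moreover have rm: "?r z \<le> m z" if "z \<in> S" for z using low[of 0 z] that by simp
    ultimately have "(\<lambda>z. if z \<in> S then ?r z else 0) \<in> A"
      using mp by (intro inA) (auto intro: order_trans)
    moreover have "(\<lambda>z. if z \<in> S then ?r z else 0) \<le> m"
      using rm m by (auto simp: le_fun_def A_def)
    \<comment> \<open>By minimality the infimum is \<open>m\<close> itself, so its term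
      \<open>t = 1\<close> yields \<open>m x \<le> m (x + y) - m y\<close>.\<close>
    ultimately have "(\<lambda>z. if z \<in> S then ?r z else 0) = m" by (rule min)
    from fun_cong[OF this, of x] have "?r x = m x" using x by simp
    with low[of 1 x] x show ?thesis by simp
  qed
  have madd: "m (x + y) = m x + m y" if "x \<in> S" "y \<in> S" for x y
    using super[OF that] sublinear_on_add[OF ms that] by simp
  have mneg: "m (- x) = - m x" if "x \<in> S" for x
    using madd[OF that subspace_neg[OF S that]] sublinear_on_zero[OF ms S] by simp
  have "m (c *\<^sub>R x) = c * m x" if x: "x \<in> S" for c x
  proof (cases "0 \<le> c")
    case True
    then show ?thesis using x by (intro sublinear_on_scale[OF ms])
  next
    case False
    then have "m (- c *\<^sub>R x) = - c * m x" using x by (intro sublinear_on_scale[OF ms]) auto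
    then show ?thesis using mneg[OF subspace_scale[OF S x], of c] by simp
  qed
  with madd have "linear_functional_on S m" by (auto simp: linear_functional_on_def)
  then show thesis using mp that by blast
qed

text \<open>The functional is obtained below the infimum over \<open>t \<ge> 0\<close> and \<open>(k, r) \<in> C\<close> of
  \<open>q (h - t k) + t r\<close>.\<close>

theorem Hahn_Banach_sandwich:
  fixes q :: "'v::real_vector \<Rightarrow> real"
  assumes S: "subspace S" and q: "sublinear_on S q"
    and C: "convex C" "C \<noteq> {}" "C \<subseteq> S \<times> UNIV"
    and above: "\<And>k r. (k, r) \<in> C \<Longrightarrow> 0 \<le> q (- k) + r"
  obtains l where "linear_functional_on S l" "\<And>x. x \<in> S \<Longrightarrow> l x \<le> q x"
    "\<And>k r. (k, r) \<in> C \<Longrightarrow> l k \<le> r"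
proof -
  define I :: "(real \<times> 'v \<times> real) set" where "I = {0..} \<times> C"
  let ?F = "\<lambda>(t, k, r) h. q (h - t *\<^sub>R k) + t * r"
  let ?p = "\<lambda>h. INF i\<in>I. ?F i h"
  have ne: "I \<noteq> {}" using C(2) by (auto simp: I_def)
  \<comment> \<open>Subadditivity for \<open>- t k = (h - t k) + (- h)\<close>, combined with
    \<open>t\<close> times the inequality \<open>above\<close>, which compensates
    \<open>t r\<close>.\<close>
  have lb: "- q (- h) \<le> ?F i h" if iI: "i \<in> I" and h: "h \<in> S" for i h
  proof -
    obtain t k r where i: "i = (t, k, r)" and t: "0 \<le> t" and kr: "(k, r) \<in> C"
      using iI by (auto simp: I_def)
    have k: "k \<in> S" using C(3) kr by blast
    have "q ((h - t *\<^sub>R k) + (- h)) \<le> q (h - t *\<^sub>R k) + q (- h)"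
      using h k S by (intro sublinear_on_add[OF q] subspace_diff subspace_neg subspace_scale)
    moreover have "q (t *\<^sub>R (- k)) = t * q (- k)"
      using t k S by (intro sublinear_on_scale[OF q] subspace_neg)
    moreover have "0 \<le> t * (q (- k) + r)" using t above[OF kr] by simp
    ultimately show ?thesis by (simp add: i algebra_simps)
  qed
  have low: "?p h \<le> ?F i h" if "i \<in> I" "h \<in> S" for i h
    using lb that by (intro cINF_lower bdd_belowI2[where m = "- q (- h)"])
  have q0: "q 0 = 0" using q S by (rule sublinear_on_zero)
  obtain k0 r0 where kr0: "(k0, r0) \<in> C" using C(2) by auto
  have "sublinear_on S ?p"
  proof (rule sublinear_on_INF[OF S ne, where F = ?F])
    show "\<And>i h. i \<in> I \<Longrightarrow> h \<in> S \<Longrightarrow> - q (- h) \<le> ?F i h" by (rule lb)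
    show "0 \<le> ?F i 0" if "i \<in> I" for i using lb[OF that subspace_0[OF S]] q0 by simp
    show "\<exists>i\<in>I. ?F i 0 \<le> 0" using kr0 q0 by (intro bexI[of _ "(0, k0, r0)"]) (auto simp: I_def)
  next
    fix i j x y assume ij: "i \<in> I" "j \<in> I" and xy: "x \<in> S" "y \<in> S"
    obtain t k r where i: "i = (t, k, r)" and t: "0 \<le> t" and kr: "(k, r) \<in> C"
      using ij(1) by (auto simp: I_def)
    obtain u k' r' where j: "j = (u, k', r')" and u: "0 \<le> u" and kr': "(k', r') \<in> C"
      using ij(2) by (auto simp: I_def)
    have k: "k \<in> S" "k' \<in> S" using C(3) kr kr' by blast+
    show "\<exists>n\<in>I. ?F n (x + y) \<le> ?F i x + ?F j y"
    proof (cases "t + u = 0")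
      case True
      then have "t = 0" "u = 0" using t u by auto
      then show ?thesis
        using sublinear_on_add[OF q xy] ij(1) by (intro bexI[of _ i]) (auto simp: i j)
    next
      case False
      \<comment> \<open>The sum of \<open>t (k, r)\<close> and \<open>u (k', r')\<close> is
        \<open>t + u\<close> times a convex combination of the two points, which lies in
        \<open>C\<close> again.\<close>
      define k2 r2 where "k2 = (t / (t + u)) *\<^sub>R k + (u / (t + u)) *\<^sub>R k'"
        and "r2 = (t / (t + u)) * r + (u / (t + u)) * r'"
      have "(t / (t + u)) *\<^sub>R (k, r) + (u / (t + u)) *\<^sub>R (k', r') \<in> C"
        using t u False kr kr' by (intro convexD[OF C(1)]) (auto simp: add_divide_distrib[symmetric])
      then have in2: "(t + u, k2, r2) \<in> I" using t u by (simp add: I_def k2_def r2_def)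
      have e1: "(t + u) *\<^sub>R k2 = t *\<^sub>R k + u *\<^sub>R k'" and e2: "(t + u) * r2 = t * r + u * r'"
        using False by (simp_all add: k2_def r2_def scaleR_add_right distrib_left)
      have "q ((x - t *\<^sub>R k) + (y - u *\<^sub>R k')) \<le> q (x - t *\<^sub>R k) + q (y - u *\<^sub>R k')"
        using xy k S by (intro sublinear_on_add[OF q] subspace_diff subspace_scale)
      moreover have "x + y - (t + u) *\<^sub>R k2 = (x - t *\<^sub>R k) + (y - u *\<^sub>R k')"
        by (simp add: e1)
      ultimately have "q (x + y - (t + u) *\<^sub>R k2) \<le> q (x - t *\<^sub>R k) + q (y - u *\<^sub>R k')"
        by (simp only:)
      then have "?F (t + u, k2, r2) (x + y) \<le> ?F i x + ?F j y"
        by (simp add: i j e2)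
      then show ?thesis using in2 by blast
    qed
  next
    fix i c x assume iI: "i \<in> I" and c: "0 < (c::real)" and x: "x \<in> S"
    obtain t k r where i: "i = (t, k, r)" and t: "0 \<le> t" and kr: "(k, r) \<in> C"
      using iI by (auto simp: I_def)
    have "q (c *\<^sub>R (x - t *\<^sub>R k)) = c * q (x - t *\<^sub>R k)"
      using c x C(3) kr S by (intro sublinear_on_scale[OF q] subspace_diff subspace_scale) auto
    then have "?F (c * t, k, r) (c *\<^sub>R x) \<le> c * ?F i x" by (simp add: i algebra_simps)
    then show "\<exists>n\<in>I. ?F n (c *\<^sub>R x) \<le> c * ?F i x"
      using t c kr by (intro bexI[of _ "(c * t, k, r)"]) (auto simp: I_def)
  qed
  then obtain l where l: "linear_functional_on S l" and lp: "\<And>x. x \<in> S \<Longrightarrow> l x \<le> ?p x"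
    using Hahn_Banach_sublinear[OF S] by blast
  \<comment> \<open>The parameter \<open>t = 0\<close> leaves \<open>q\<close>; the parameter
    \<open>t = 1\<close> at \<open>h = k\<close> leaves \<open>q 0 + r = r\<close>.\<close>
  have "l x \<le> q x" if x: "x \<in> S" for x
    using lp[OF x] low[of "(0, k0, r0)" x] kr0 x by (simp add: I_def)
  moreover have "l k \<le> r" if "(k, r) \<in> C" for k r
  proof -
    have "k \<in> S" using C(3) that by blast
    then show ?thesis using lp[of k] low[of "(1, k, r)" k] that q0 by (simp add: I_def)
  qed
  ultimately show thesis using l that by blast
qed


section \<open>Bounded functionals on $L^1$\<close>

text \<open>Pointwise scaling makes the functions a real vector space, as the Hahn-Banach theorems
  above require.\<close>

instantiation "fun" :: (type, scaleR) scaleR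
begin
definition scaleR_fun :: "real \<Rightarrow> ('a \<Rightarrow> 'b) \<Rightarrow> 'a \<Rightarrow> 'b" where
  "scaleR_fun c f = (\<lambda>x. c *\<^sub>R f x)"
instance ..
end

instance "fun" :: (type, real_vector) real_vector
  by standard (auto simp: scaleR_fun_def fun_eq_iff algebra_simps)

lemma L1_space_iff [simp]: "f \<in> L1_space M \<longleftrightarrow> integrable M f"
  by (simp add: L1_space_def)

lemma subspace_L1_space: "subspace (L1_space M)"
  by (auto simp: subspace_def zero_fun_def plus_fun_def scaleR_fun_def)

lemma sublinear_on_L1_norm:
  assumes "0 \<le> L"
  shows "sublinear_on (L1_space M) (\<lambda>f. L * (\<integral>x. \<bar>f x\<bar> \<partial>M))"
proof -
  have "L * (\<integral>x. \<bar>f x + g x\<bar> \<partial>M) \<le> L * (\<integral>x. \<bar>f x\<bar> \<partial>M) + L * (\<integral>x. \<bar>g x\<bar> \<partial>M)"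
    if "integrable M f" "integrable M g" for f g :: "'a \<Rightarrow> real"
  proof -
    have "(\<integral>x. \<bar>f x + g x\<bar> \<partial>M) \<le> (\<integral>x. \<bar>f x\<bar> + \<bar>g x\<bar> \<partial>M)"
      using that by (intro integral_mono) auto
    also have "\<dots> = (\<integral>x. \<bar>f x\<bar> \<partial>M) + (\<integral>x. \<bar>g x\<bar> \<partial>M)"
      using that by simp
    finally show ?thesis using assms by (simp add: distrib_left[symmetric] mult_left_mono)
  qed
  then show ?thesis by (auto simp: sublinear_on_def plus_fun_def scaleR_fun_def abs_mult)
qed

text \<open>Duality of L^1 and L^infinity with control of the norm. The values of \<open>l\<close>
  on indicators, shifted by \<open>L\<close> times the measure, form a positive measure; its
  Radon-Nikodym derivative, shifted back, represents \<open>l\<close> on indicators, and continuity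
  extends this to all integrable functions.\<close>

lemma (in finite_measure) L1_functional_representation:
  assumes L: "0 \<le> L" and l: "linear_functional_on (L1_space M) l"
    and le: "\<And>f. integrable M f \<Longrightarrow> l f \<le> L * (\<integral>x. \<bar>f x\<bar> \<partial>M)"
  obtains g where "g \<in> borel_measurable M" "\<And>x. \<bar>g x\<bar> \<le> L"
    "\<And>f. integrable M f \<Longrightarrow> l f = (\<integral>x. g x * f x \<partial>M)"
proof -
  have l_add: "l (\<lambda>x. f x + g x) = l f + l g" if "integrable M f" "integrable M g" for f g
    using l that by (simp add: linear_functional_on_def plus_fun_def)
  have l_scale: "l (\<lambda>x. c * f x) = c * l f" if "integrable M f" for c f
    using l that by (simp add: linear_functional_on_def scaleR_fun_def)
  have l_diff: "l (\<lambda>x. f x - g x) = l f - l g" if "integrable M f" "integrable M g" for f g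
    using l_add[of f "\<lambda>x. -1 * g x"] l_scale[of g "-1"] that by simp
  have bound: "\<bar>l f\<bar> \<le> L * (\<integral>x. \<bar>f x\<bar> \<partial>M)" if "integrable M f" for f
    using le[OF that] le[of "\<lambda>x. -1 * f x"] l_scale[OF that, of "-1"] that by (simp add: abs_le_iff)
  \<comment> \<open>Since \<open>l\<close> of an indicator is at most \<open>L * measure M A\<close>
    in absolute value, the shift places \<nu> between \<open>0\<close> and
    \<open>2 * L * measure M A\<close>.\<close>
  define \<nu> where "\<nu> A = l (indicator A) + L * measure M A" for A
  have int_ind: "integrable M (indicator A :: 'a \<Rightarrow> real)" if "A \<in> sets M" for A
    using that by (simp add: emeasure_eq_measure)
  have l_ind: "\<bar>l (indicator A)\<bar> \<le> L * measure M A" if "A \<in> sets M" for A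
    using bound[OF int_ind[OF that]] that by simp
  have \<nu>_nonneg: "0 \<le> \<nu> A" and \<nu>_le: "\<nu> A \<le> 2 * L * measure M A" if "A \<in> sets M" for A
    using l_ind[OF that] by (auto simp: \<nu>_def abs_le_iff)
  have \<nu>_empty: "\<nu> {} = 0" using l_ind[of "{}"] by (simp add: \<nu>_def)
  define N where "N = measure_of (space M) (sets M) (\<lambda>A. ennreal (\<nu> A))"
  have pos: "positive (sets M) (\<lambda>A. ennreal (\<nu> A))" by (simp add: positive_def \<nu>_empty)
  \<comment> \<open>Finite additivity and continuity at the empty set suffice; the latter is
    inherited from \<open>M\<close> through the upper bound on \<nu>.\<close>
  have "countably_additive (sets M) (\<lambda>A. ennreal (\<nu> A))"
  proof (rule sets.empty_continuous_imp_countably_additive[OF pos])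
    show "additive (sets M) (\<lambda>A. ennreal (\<nu> A))"
      unfolding additive_def
    proof (intro ballI impI)
      fix A B assume AB: "A \<in> sets M" "B \<in> sets M" "A \<inter> B = {}"
      have "(indicator (A \<union> B) :: 'a \<Rightarrow> real) = (\<lambda>x. indicator A x + indicator B x)"
        using AB(3) by (auto simp: fun_eq_iff indicator_def)
      then have "\<nu> (A \<union> B) = \<nu> A + \<nu> B"
        using l_add[OF int_ind int_ind, OF AB(1,2)] finite_measure_Union[OF AB]
        by (simp add: \<nu>_def distrib_left)
      then show "ennreal (\<nu> (A \<union> B)) = ennreal (\<nu> A) + ennreal (\<nu> B)"
        using \<nu>_nonneg AB by simp
    qed
    fix A :: "nat \<Rightarrow> 'a set"
    assume A: "range A \<subseteq> sets M" "decseq A" "(\<Inter>i. A i) = {}"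
    have "(\<lambda>i. 2 * L * measure M (A i)) \<longlonglongrightarrow> 2 * L * 0"
      using finite_Lim_measure_decseq[OF A(1,2)] A(3) by (intro tendsto_mult_left) simp
    then have lim: "(\<lambda>i. 2 * L * measure M (A i)) \<longlonglongrightarrow> 0" by simp
    have "A i \<in> sets M" for i using A(1) by blast
    then have "(\<lambda>i. \<nu> (A i)) \<longlonglongrightarrow> 0"
      by (intro tendsto_sandwich[OF _ _ tendsto_const lim] always_eventually allI \<nu>_nonneg \<nu>_le)
    from tendsto_ennrealI[OF this] show "(\<lambda>i. ennreal (\<nu> (A i))) \<longlonglongrightarrow> 0" by simp
  qed simp
  then have N: "sets N = sets M" "\<And>A. A \<in> sets M \<Longrightarrow> emeasure N A = ennreal (\<nu> A)"
    using pos by (auto simp: N_def emeasure_measure_of_sigma sets.sigma_algebra_axioms)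
  have "absolutely_continuous M N"
    unfolding absolutely_continuous_def
  proof
    fix A assume "A \<in> null_sets M"
    then have A: "A \<in> sets M" "measure M A = 0" by (auto simp: null_sets_def measure_def)
    then have "\<nu> A = 0" using \<nu>_nonneg[of A] \<nu>_le[of A] by simp
    then show "A \<in> null_sets N" using A N by (simp add: null_sets_def)
  qed
  then obtain f where f: "f \<in> borel_measurable M" "density M f = N"
    using Radon_Nikodym N(1) by blast
  have "(\<integral>\<^sup>+x. f x \<partial>M) = emeasure (density M f) (space M)"
    using f(1) by (simp add: emeasure_density cong: nn_integral_cong)
  then have "(\<integral>\<^sup>+x. f x \<partial>M) = emeasure N (space M)" by (simp only: f(2))
  then have fin: "(\<integral>\<^sup>+x. f x \<partial>M) \<noteq> \<infinity>" using N(2) by simp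
  \<comment> \<open>The derivative \<open>f\<close> has values in \<open>ennreal\<close>; its
    integral is finite, so \<open>d\<close> is a real version of it almost everywhere.\<close>
  define d where "d x = enn2real (f x)" for x
  have dm: "d \<in> borel_measurable M" using f(1) unfolding d_def by measurable
  have fd: "AE x in M. f x = ennreal (d x)"
    using nn_integral_PInf_AE[OF f(1) fin] by eventually_elim (auto simp: d_def less_top)
  have nn_d: "(\<integral>\<^sup>+x. ennreal (d x) * indicator A x \<partial>M) = ennreal (\<nu> A)" if A: "A \<in> sets M" for A
  proof -
    have "(\<integral>\<^sup>+x. ennreal (d x) * indicator A x \<partial>M) = (\<integral>\<^sup>+x. f x * indicator A x \<partial>M)"
      using fd by (intro nn_integral_cong_AE) auto
    also have "\<dots> = emeasure (density M f) A" using f(1) A by (simp add: emeasure_density)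
    also have "\<dots> = ennreal (\<nu> A)" by (simp only: f(2) N(2)[OF A])
    finally show ?thesis .
  qed
  have d_int: "(\<integral>x. d x * indicator A x \<partial>M) = \<nu> A" if A: "A \<in> sets M" for A
  proof -
    have "(\<integral>\<^sup>+x. ennreal (d x * indicator A x) \<partial>M) = ennreal (\<nu> A)"
      unfolding nn_d[OF A, symmetric] by (intro nn_integral_cong) (auto simp: indicator_def)
    moreover have "AE x in M. 0 \<le> d x * indicator A x" by (simp add: d_def)
    ultimately show ?thesis
      using dm A \<nu>_nonneg[OF A] by (simp add: integral_eq_nn_integral)
  qed
  have intd: "integrable M d"
  proof (rule integrableI_nonneg[OF dm])
    show "AE x in M. 0 \<le> d x" by (simp add: d_def)
    have "(\<integral>\<^sup>+x. ennreal (d x) \<partial>M) = (\<integral>\<^sup>+x. ennreal (d x) * indicator (space M) x \<partial>M)"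
      by (intro nn_integral_cong) auto
    then show "(\<integral>\<^sup>+x. ennreal (d x) \<partial>M) < \<infinity>" using nn_d[of "space M"] by simp
  qed
  have avg: "set_lebesgue_integral M A (\<lambda>x. d x - L) = l (indicator A)" if A: "A \<in> sets M" for A
  proof -
    have "set_lebesgue_integral M A (\<lambda>x. d x - L) = (\<integral>x. d x * indicator A x - L * indicator A x \<partial>M)"
      by (simp add: set_lebesgue_integral_def algebra_simps)
    also have "\<dots> = \<nu> A - L * measure M A"
      using d_int[OF A] int_ind[OF A] A integrable_real_mult_indicator[OF A intd]
      by (subst Bochner_Integration.integral_diff) (auto intro: integrable_mult_right)
    finally show ?thesis by (simp add: \<nu>_def)
  qed
  \<comment> \<open>The averages of \<open>d - L\<close> over sets of positive measure are
    \<open>l (indicator A) / measure M A\<close> and lie in a closed interval, hence so do almost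
    all values.\<close>
  have dL: "AE x in M. d x - L \<in> {-L..L}"
  proof (rule averaging_theorem)
    show "integrable M (\<lambda>x. d x - L)" using intd by simp
    fix A assume A: "A \<in> sets M" "0 < measure M A"
    show "(1 / measure M A) *\<^sub>R set_lebesgue_integral M A (\<lambda>x. d x - L) \<in> {-L..L}"
      using l_ind[OF A(1)] A(2) by (simp add: avg[OF A(1)] abs_le_iff field_simps)
  qed simp
  \<comment> \<open>Clipping alters \<open>d - L\<close> on a null set only and makes the bound hold
    everywhere.\<close>
  define g where "g x = max (- L) (min L (d x - L))" for x
  have gm: "g \<in> borel_measurable M" using dm unfolding g_def by measurable
  have gb: "\<bar>g x\<bar> \<le> L" for x using L by (auto simp: g_def)
  have gd: "AE x in M. g x = d x - L" using dL by eventually_elim (auto simp: g_def)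
  have intg: "integrable M (\<lambda>x. g x * f x)" if "integrable M f" for f
  proof (rule Bochner_Integration.integrable_bound)
    show "integrable M (\<lambda>x. L * f x)" using that by simp
    show "AE x in M. norm (g x * f x) \<le> norm (L * f x)"
      using gb L by (auto simp: abs_mult intro!: mult_right_mono)
  qed (use gm that in auto)
  have rep: "l f = (\<integral>x. g x * f x \<partial>M)" if "integrable M f" for f
    using that
  proof (induction rule: integrable_induct)
    case (base A c)
    have "(\<integral>x. g x * indicator A x \<partial>M) = set_lebesgue_integral M A (\<lambda>x. d x - L)"
      unfolding set_lebesgue_integral_def using gd gm dm base(1)
      by (intro integral_cong_AE) auto
    then have "l (indicator A) = (\<integral>x. g x * indicator A x \<partial>M)" using avg[OF base(1)] by simp
    moreover have "indicator A x *\<^sub>R c = c * indicator A x" for x by simp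
    moreover have "(\<integral>x. g x * (c * indicator A x) \<partial>M) = c * (\<integral>x. g x * indicator A x \<partial>M)"
      by (subst integral_mult_right_zero[symmetric]) (simp only: mult.left_commute)
    ultimately show ?case using l_scale[OF int_ind[OF base(1)], of c] by (simp only:)
  next
    case (add f1 f2)
    then show ?case using l_add[of f1 f2] intg by (simp add: distrib_left)
  next
    case (lim f s)
    \<comment> \<open>The approximating simple functions satisfy
      \<open>\<bar>s i x\<bar> \<le> 2 * \<bar>f x\<bar>\<close>, which explains the factor
      \<open>3\<close> in the dominating function.\<close>
    have conv: "(\<lambda>i. \<integral>x. \<bar>s i x - f x\<bar> \<partial>M) \<longlonglongrightarrow> (\<integral>x. 0 \<partial>M)"
    proof (rule integral_dominated_convergence[where w = "\<lambda>x. 3 * \<bar>f x\<bar>"])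
      show "AE x in M. (\<lambda>i. \<bar>s i x - f x\<bar>) \<longlonglongrightarrow> 0"
        using lim.hyps(2) by (intro AE_I2 tendsto_rabs_zero LIM_zero)
      show "AE x in M. norm \<bar>s i x - f x\<bar> \<le> 3 * \<bar>f x\<bar>" for i
      proof (rule AE_I2)
        fix x assume "x \<in> space M"
        then have "\<bar>s i x\<bar> \<le> 2 * \<bar>f x\<bar>" using lim.hyps(3) by simp
        then show "norm \<bar>s i x - f x\<bar> \<le> 3 * \<bar>f x\<bar>" by (simp add: abs_if split: if_splits)
      qed
    qed (use lim in auto)
    \<comment> \<open>One \<open>L\<close> estimates \<open>l (s i) - l f\<close>, the other the
      corresponding difference of integrals against \<open>g\<close>.\<close>
    define err where "err i = 2 * L * (\<integral>x. \<bar>s i x - f x\<bar> \<partial>M)" for i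
    have "err \<longlonglongrightarrow> 2 * L * 0" unfolding err_def using conv by (intro tendsto_mult_left) simp
    moreover have "\<bar>l f - (\<integral>x. g x * f x \<partial>M)\<bar> \<le> err i" for i
    proof -
      have int: "integrable M (\<lambda>x. s i x - f x)" using lim by simp
      have "\<bar>\<integral>x. g x * (s i x - f x) \<partial>M\<bar> \<le> (\<integral>x. \<bar>g x * (s i x - f x)\<bar> \<partial>M)"
        by (rule integral_abs_bound)
      also have "\<dots> \<le> (\<integral>x. L * \<bar>s i x - f x\<bar> \<partial>M)"
      proof (rule integral_mono)
        show "integrable M (\<lambda>x. \<bar>g x * (s i x - f x)\<bar>)" by (rule integrable_abs[OF intg[OF int]])
        show "integrable M (\<lambda>x. L * \<bar>s i x - f x\<bar>)" using int by simp
        show "\<bar>g x * (s i x - f x)\<bar> \<le> L * \<bar>s i x - f x\<bar>" for x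
          using gb[of x] by (simp add: abs_mult mult_right_mono)
      qed
      finally have 1: "\<bar>\<integral>x. g x * (s i x - f x) \<partial>M\<bar> \<le> L * (\<integral>x. \<bar>s i x - f x\<bar> \<partial>M)" by simp
      have 2: "(\<integral>x. g x * (s i x - f x) \<partial>M) = (\<integral>x. g x * s i x \<partial>M) - (\<integral>x. g x * f x \<partial>M)"
        using intg lim by (simp add: right_diff_distrib)
      have 3: "\<bar>l (s i) - l f\<bar> \<le> L * (\<integral>x. \<bar>s i x - f x\<bar> \<partial>M)"
        using bound[OF int] l_diff[of "s i" f] lim by simp
      show ?thesis using 1 2 3 lim.IH[of i] by (simp add: err_def abs_le_iff)
    qed
    ultimately have "\<bar>l f - (\<integral>x. g x * f x \<partial>M)\<bar> \<le> 2 * L * 0"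
      by (intro LIMSEQ_le_const[of err]) auto
    then show ?case by simp
  qed
  show thesis using that gm gb rep by blast
qed


section \<open>The strong and the weak topology\<close>

lemma topspace_L1_strong [simp]: "topspace (L1_strong_topology M) = L1_space M"
  unfolding L1_strong_topology_def topology_generated_by_topspace
proof (intro equalityI subsetI)
  fix f assume f: "f \<in> L1_space M"
  then have "f \<in> {g \<in> L1_space M. (\<integral>x. \<bar>g x - f x\<bar> \<partial>M) < 1}" by simp
  with f show "f \<in> \<Union> {{g \<in> L1_space M. (\<integral>x. \<bar>g x - f x\<bar> \<partial>M) < e} |f e. f \<in> L1_space M \<and> e > 0}"
    using zero_less_one by blast
qed blast

lemma topspace_L1_weak [simp]: "topspace (L1_weak_topology M) = L1_space M"
  unfolding L1_weak_topology_def topology_generated_by_topspace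
proof (intro equalityI subsetI)
  fix f assume f: "f \<in> L1_space M"
  have "(\<lambda>x. 0) \<in> Linf_space M" by (auto simp: Linf_space_def)
  moreover have "f \<in> {f \<in> L1_space M. (\<integral>x. f x * 0 \<partial>M) \<in> (UNIV :: real set)}" using f by simp
  ultimately show "f \<in> \<Union> {{f \<in> L1_space M. (\<integral>x. f x * g x \<partial>M) \<in> V} |g V.
      g \<in> Linf_space M \<and> open V}"
    using open_UNIV by blast
qed blast

lemma L1_dist_triangle:
  fixes f g h :: "'a \<Rightarrow> real"
  assumes "integrable M f" "integrable M g" "integrable M h"
  shows "(\<integral>x. \<bar>f x - h x\<bar> \<partial>M) \<le> (\<integral>x. \<bar>f x - g x\<bar> \<partial>M) + (\<integral>x. \<bar>g x - h x\<bar> \<partial>M)"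
proof -
  have "(\<integral>x. \<bar>f x - h x\<bar> \<partial>M) \<le> (\<integral>x. \<bar>f x - g x\<bar> + \<bar>g x - h x\<bar> \<partial>M)"
    using assms by (intro integral_mono) auto
  then show ?thesis using assms by simp
qed

text \<open>By the triangle inequality each ball contains a ball around each of its points. The
  balls are therefore a base, and the generated topology is that of the seminorm.\<close>

lemma openin_L1_strong_iff:
  "openin (L1_strong_topology M) U \<longleftrightarrow> U \<subseteq> L1_space M \<and>
    (\<forall>f\<in>U. \<exists>e>0. \<forall>g\<in>L1_space M. (\<integral>x. \<bar>g x - f x\<bar> \<partial>M) < e \<longrightarrow> g \<in> U)"
proof
  let ?B = "\<lambda>f e. {g \<in> L1_space M. (\<integral>x. \<bar>g x - f x\<bar> \<partial>M) < e}"
  let ?P = "\<lambda>U. \<forall>f\<in>U. \<exists>e>0. ?B f e \<subseteq> U"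
  assume op: "openin (L1_strong_topology M) U"
  then have "generate_topology_on {?B f e |f e. f \<in> L1_space M \<and> e > 0} U"
    by (simp add: L1_strong_topology_def openin_topology_generated_by_iff)
  then have "?P U"
  proof (induction rule: generate_topology_on.induct)
    case (Int a b)
    show ?case
    proof
      fix f assume "f \<in> a \<inter> b"
      then obtain d e where "d > 0" "?B f d \<subseteq> a" "e > 0" "?B f e \<subseteq> b" using Int.IH by blast
      then show "\<exists>e>0. ?B f e \<subseteq> a \<inter> b" by (intro exI[of _ "min d e"]) auto
    qed
  next
    case (UN K)
    show ?case
    proof
      fix f assume "f \<in> \<Union>K"
      then obtain k where k: "k \<in> K" "f \<in> k" by blast
      then obtain e where "e > 0" "?B f e \<subseteq> k" using UN.IH by blast
      then show "\<exists>e>0. ?B f e \<subseteq> \<Union>K" using k by blast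
    qed
  next
    case (Basis s)
    then obtain h r where s: "s = ?B h r" and h: "h \<in> L1_space M" by blast
    show ?case
    proof
      fix f assume f: "f \<in> s"
      have "?B f (r - (\<integral>x. \<bar>f x - h x\<bar> \<partial>M)) \<subseteq> s"
      proof
        fix g assume "g \<in> ?B f (r - (\<integral>x. \<bar>f x - h x\<bar> \<partial>M))"
        then show "g \<in> s" using L1_dist_triangle[of M g f h] f h by (simp add: s)
      qed
      then show "\<exists>e>0. ?B f e \<subseteq> s"
        using f by (intro exI[of _ "r - (\<integral>x. \<bar>f x - h x\<bar> \<partial>M)"]) (auto simp: s)
    qed
  qed simp
  moreover have "U \<subseteq> L1_space M" using openin_subset[OF op] by simp
  ultimately show "U \<subseteq> L1_space M \<and> (\<forall>f\<in>U. \<exists>e>0. \<forall>g\<in>L1_space M.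
      (\<integral>x. \<bar>g x - f x\<bar> \<partial>M) < e \<longrightarrow> g \<in> U)" by blast
next
  assume U: "U \<subseteq> L1_space M \<and> (\<forall>f\<in>U. \<exists>e>0. \<forall>g\<in>L1_space M.
    (\<integral>x. \<bar>g x - f x\<bar> \<partial>M) < e \<longrightarrow> g \<in> U)"
  show "openin (L1_strong_topology M) U"
  proof (subst openin_subopen, intro ballI)
    fix f assume f: "f \<in> U"
    then obtain e where e: "e > 0" "\<forall>g\<in>L1_space M. (\<integral>x. \<bar>g x - f x\<bar> \<partial>M) < e \<longrightarrow> g \<in> U"
      using U by blast
    let ?V = "{g \<in> L1_space M. (\<integral>x. \<bar>g x - f x\<bar> \<partial>M) < e}"
    have "openin (L1_strong_topology M) ?V"
      unfolding L1_strong_topology_def using U f e(1) by (intro topology_generated_by_Basis) blast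
    moreover have "f \<in> ?V" using U f e(1) by auto
    ultimately show "\<exists>T. openin (L1_strong_topology M) T \<and> f \<in> T \<and> T \<subseteq> U" using e(2) by blast
  qed
qed

lemma Linf_pairing:
  assumes "g \<in> Linf_space M"
  obtains C where "0 \<le> C" "\<And>f. integrable M f \<Longrightarrow> integrable M (\<lambda>x. f x * g x)"
    "\<And>f. integrable M f \<Longrightarrow> \<bar>\<integral>x. f x * g x \<partial>M\<bar> \<le> C * (\<integral>x. \<bar>f x\<bar> \<partial>M)"
proof -
  from assms obtain B where g: "g \<in> borel_measurable M" and B: "AE x in M. \<bar>g x\<bar> \<le> B"
    by (auto simp: Linf_space_def)
  \<comment> \<open>If the whole space is null, the almost everywhere bound \<open>B\<close> may be
    negative.\<close>
  let ?C = "max B 0"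
  have int: "integrable M (\<lambda>x. f x * g x)" if "integrable M f" for f
  proof (rule Bochner_Integration.integrable_bound)
    show "integrable M (\<lambda>x. f x * ?C)" using that by simp
    show "AE x in M. norm (f x * g x) \<le> norm (f x * ?C)"
      using B by eventually_elim (auto simp: abs_mult intro!: mult_left_mono)
  qed (use g that in auto)
  have "\<bar>\<integral>x. f x * g x \<partial>M\<bar> \<le> ?C * (\<integral>x. \<bar>f x\<bar> \<partial>M)" if "integrable M f" for f
  proof -
    have "\<bar>\<integral>x. f x * g x \<partial>M\<bar> \<le> (\<integral>x. \<bar>f x * g x\<bar> \<partial>M)" by (rule integral_abs_bound)
    also have "\<dots> \<le> (\<integral>x. ?C * \<bar>f x\<bar> \<partial>M)"
    proof (rule integral_mono_AE)
      show "AE x in M. \<bar>f x * g x\<bar> \<le> ?C * \<bar>f x\<bar>"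
        using B
      proof eventually_elim
        case (elim x)
        then have "\<bar>f x\<bar> * \<bar>g x\<bar> \<le> \<bar>f x\<bar> * ?C" by (intro mult_left_mono) auto
        then show ?case by (simp add: abs_mult mult.commute)
      qed
    qed (use int[OF that] that in auto)
    finally show ?thesis using that by simp
  qed
  with int show thesis using that[of ?C] by auto
qed

text \<open>The pairing with \<open>g\<close> is Lipschitz for the seminorm, so the generators of
  the weak topology are strongly open.\<close>

lemma openin_L1_strong_halfspace:
  assumes g: "g \<in> Linf_space M" and V: "open V"
  shows "openin (L1_strong_topology M) {f \<in> L1_space M. (\<integral>x. f x * g x \<partial>M) \<in> V}"
  unfolding openin_L1_strong_iff
proof (intro conjI ballI)
  fix f assume f: "f \<in> {f \<in> L1_space M. (\<integral>x. f x * g x \<partial>M) \<in> V}"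
  obtain C where C: "0 \<le> C" "\<And>f. integrable M f \<Longrightarrow> integrable M (\<lambda>x. f x * g x)"
    "\<And>f. integrable M f \<Longrightarrow> \<bar>\<integral>x. f x * g x \<partial>M\<bar> \<le> C * (\<integral>x. \<bar>f x\<bar> \<partial>M)"
    using Linf_pairing[OF g] by blast
  obtain e where e: "e > 0" "\<And>y. \<bar>y - (\<integral>x. f x * g x \<partial>M)\<bar> < e \<Longrightarrow> y \<in> V"
    using V f unfolding open_dist dist_real_def by blast
  \<comment> \<open>The radius has the denominator \<open>C + 1\<close> because \<open>C\<close> may
    be \<open>0\<close>.\<close>
  have "(\<integral>x. h x * g x \<partial>M) \<in> V"
    if h: "integrable M h" and close: "(\<integral>x. \<bar>h x - f x\<bar> \<partial>M) < e / (C + 1)" for h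
  proof (rule e(2))
    have "\<bar>(\<integral>x. h x * g x \<partial>M) - (\<integral>x. f x * g x \<partial>M)\<bar> = \<bar>\<integral>x. (h x - f x) * g x \<partial>M\<bar>"
      using C(2) h f by (simp add: left_diff_distrib)
    also have "\<dots> \<le> C * (\<integral>x. \<bar>h x - f x\<bar> \<partial>M)" using h f by (intro C(3)) auto
    also have "\<dots> \<le> (C + 1) * (\<integral>x. \<bar>h x - f x\<bar> \<partial>M)" by (intro mult_right_mono) auto
    also have "\<dots> < e" using close C(1) by (simp add: field_simps)
    finally show "\<bar>(\<integral>x. h x * g x \<partial>M) - (\<integral>x. f x * g x \<partial>M)\<bar> < e" .
  qed
  then show "\<exists>e>0. \<forall>h\<in>L1_space M. (\<integral>x. \<bar>h x - f x\<bar> \<partial>M) < e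
      \<longrightarrow> h \<in> {f \<in> L1_space M. (\<integral>x. f x * g x \<partial>M) \<in> V}"
    using e(1) C(1) by (intro exI[of _ "e / (C + 1)"]) auto
qed auto

lemma openin_L1_weak_imp_strong:
  assumes "openin (L1_weak_topology M) U"
  shows "openin (L1_strong_topology M) U"
proof (rule generate_topology_on_coarsest)
  show "generate_topology_on
    {{f \<in> L1_space M. (\<integral>x. f x * g x \<partial>M) \<in> V} |g V. g \<in> Linf_space M \<and> open V} U"
    using assms by (simp add: L1_weak_topology_def openin_topology_generated_by_iff)
  show "istopology (openin (L1_strong_topology M))" by (rule istopology_openin)
qed (blast intro: openin_L1_strong_halfspace)

lemma lsc_L1_weak_imp_strong:
  "lsc_wrt (L1_weak_topology M) F \<Longrightarrow> lsc_wrt (L1_strong_topology M) F"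
  by (auto simp: lsc_wrt_def openin_L1_weak_imp_strong)

lemma bounded_measurable_subset_Linf: "bounded_measurable M \<subseteq> Linf_space M"
  by (auto simp: bounded_measurable_def Linf_space_def)


section \<open>Affine minorants of convex lower semicontinuous functions\<close>

text \<open>The minorant passes through height \<open>a\<close> at \<open>D\<close> and has a
  bounded slope \<open>g\<close>. It supplies weakly open neighbourhoods as well as acceptable
  positions.\<close>

lemma (in finite_measure) convex_lsc_affine_minorant:
  assumes conv: "convex_on_L1 M F" and lsc: "lsc_wrt (L1_strong_topology M) F"
    and lower: "\<And>f. integrable M f \<Longrightarrow> ereal c \<le> F f"
    and D: "integrable M D" and a: "ereal a < F D"
  obtains g where "g \<in> bounded_measurable M"
    "\<And>f. integrable M f \<Longrightarrow> ereal (a + ((\<integral>x. f x * g x \<partial>M) - (\<integral>x. D x * g x \<partial>M))) \<le> F f"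
proof (cases "\<forall>f. integrable M f \<longrightarrow> F f = \<infinity>")
  \<comment> \<open>Without a finite value the set \<open>C\<close> below would be empty and the
    sandwich theorem inapplicable; slope \<open>0\<close> works.\<close>
  case True
  then show thesis using that[of "\<lambda>x. 0"] bounded_measurable_const by auto
next
  case False
  have "openin (L1_strong_topology M) {f \<in> L1_space M. ereal a < F f}"
    using lsc by (simp add: lsc_wrt_def)
  moreover have "D \<in> {f \<in> L1_space M. ereal a < F f}" using D a by simp
  ultimately obtain e where e: "e > 0"
    and sub: "\<forall>f\<in>L1_space M. (\<integral>x. \<bar>f x - D x\<bar> \<partial>M) < e \<longrightarrow> f \<in> {f \<in> L1_space M. ereal a < F f}"
    unfolding openin_L1_strong_iff by blast
  have ball: "ereal a < F f" if "integrable M f" "(\<integral>x. \<bar>f x - D x\<bar> \<partial>M) < e" for f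
    using sub that by simp
  \<comment> \<open>With this slope the cone \<open>a - L \<parallel>f - D\<parallel>\<close> has
    fallen to \<open>c\<close> or lower at distance \<open>e\<close> from \<open>D\<close>.\<close>
  define L where "L = max 0 ((a - c) / e)"
  have L: "0 \<le> L" "a - c \<le> L * e" using e by (auto simp: L_def max_def field_simps)
  let ?q = "\<lambda>f. L * (\<integral>x. \<bar>f x\<bar> \<partial>M)"
  \<comment> \<open>The epigraph of \<open>F\<close>, translated so that the point
    \<open>(D, a)\<close> becomes the origin.\<close>
  define C where "C = {(k, r). integrable M k \<and> F (\<lambda>x. D x + k x) \<le> ereal (a + r)}"
  have in_C: "((\<lambda>x. f x - D x), r - a) \<in> C" if "integrable M f" "F f = ereal r" for f r
    using that D by (simp add: C_def)
  have convC: "convex C"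
  proof (rule convexI)
    fix y z :: "('a \<Rightarrow> real) \<times> real" and u v :: real
    assume yz: "y \<in> C" "z \<in> C" and uv: "0 \<le> u" "0 \<le> v" "u + v = 1"
    obtain k r where y: "y = (k, r)" "integrable M k" "F (\<lambda>x. D x + k x) \<le> ereal (a + r)"
      using yz(1) by (auto simp: C_def)
    obtain k' r' where z: "z = (k', r')" "integrable M k'" "F (\<lambda>x. D x + k' x) \<le> ereal (a + r')"
      using yz(2) by (auto simp: C_def)
    have v: "v = 1 - u" using uv(3) by simp
    have "F (\<lambda>x. u * (D x + k x) + (1 - u) * (D x + k' x))
        \<le> ereal u * F (\<lambda>x. D x + k x) + ereal (1 - u) * F (\<lambda>x. D x + k' x)"
      using conv y(2) z(2) D uv unfolding convex_on_L1_def by simp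
    also have "\<dots> \<le> ereal u * ereal (a + r) + ereal (1 - u) * ereal (a + r')"
      using y(3) z(3) uv v by (intro add_mono ereal_mult_left_mono) auto
    also have "\<dots> = ereal (a + (u * r + v * r'))" by (simp add: v algebra_simps)
    also have "(\<lambda>x. u * (D x + k x) + (1 - u) * (D x + k' x)) = (\<lambda>x. D x + (u * k x + v * k' x))"
      by (simp add: v fun_eq_iff algebra_simps)
    finally show "u *\<^sub>R y + v *\<^sub>R z \<in> C"
      using y(2) z(2) by (simp add: C_def y(1) z(1) plus_fun_def scaleR_fun_def)
  qed
  have neC: "C \<noteq> {}"
  proof -
    obtain f where f: "integrable M f" "F f \<noteq> \<infinity>" using False by blast
    then obtain r where "F f = ereal r" using lower[of f] by (cases "F f") auto
    then show ?thesis using in_C f(1) by blast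
  qed
  have above: "0 \<le> ?q (- k) + r" if kr: "(k, r) \<in> C" for k r
  proof -
    have k: "integrable M k" and F: "F (\<lambda>x. D x + k x) \<le> ereal (a + r)" using kr by (auto simp: C_def)
    have q: "?q (- k) = ?q k" by simp
    show ?thesis
    \<comment> \<open>Inside the ball semicontinuity forces \<open>r\<close> to be nonnegative;
      outside, the lower bound \<open>c\<close> and the choice of \<open>L\<close> take
      over.\<close>
    proof (cases "(\<integral>x. \<bar>k x\<bar> \<partial>M) < e")
      case True
      then have "ereal a < F (\<lambda>x. D x + k x)" using k D by (intro ball) auto
      also note F
      finally have "0 \<le> r" by simp
      then show ?thesis using L unfolding q by simp
    next
      case False
      have "ereal c \<le> F (\<lambda>x. D x + k x)" using k D by (intro lower) auto
      also note F
      finally have "c \<le> a + r" by simp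
      moreover have "L * e \<le> ?q k" using False L(1) by (intro mult_left_mono) auto
      ultimately show ?thesis using L(2) unfolding q by simp
    qed
  qed
  have subC: "C \<subseteq> L1_space M \<times> UNIV" by (auto simp: C_def)
  obtain l where l: "linear_functional_on (L1_space M) l"
    and lq: "\<And>f. f \<in> L1_space M \<Longrightarrow> l f \<le> ?q f" and lC: "\<And>k r. (k, r) \<in> C \<Longrightarrow> l k \<le> r"
    using Hahn_Banach_sandwich[of "L1_space M" ?q C, OF subspace_L1_space sublinear_on_L1_norm[OF L(1)] convC neC subC above]
    by blast
  obtain g where g: "g \<in> borel_measurable M" "\<And>x. \<bar>g x\<bar> \<le> L"
    and rep: "\<And>f. integrable M f \<Longrightarrow> l f = (\<integral>x. g x * f x \<partial>M)"
    using L1_functional_representation[OF L(1) l] lq by auto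
  have gb: "g \<in> bounded_measurable M" using g by (auto simp: bounded_measurable_def)
  then have "g \<in> Linf_space M" using bounded_measurable_subset_Linf by blast
  then have int: "integrable M (\<lambda>x. f x * g x)" if "integrable M f" for f
    using that Linf_pairing by blast
  have "ereal (a + ((\<integral>x. f x * g x \<partial>M) - (\<integral>x. D x * g x \<partial>M))) \<le> F f"
    if f: "integrable M f" for f
  proof (cases "F f")
    case (real r)
    have "(\<integral>x. g x * (f x - D x) \<partial>M) \<le> r - a"
      using lC[OF in_C[OF f real]] rep[of "\<lambda>x. f x - D x"] f D by simp
    moreover have "(\<integral>x. g x * (f x - D x) \<partial>M) = (\<integral>x. f x * g x \<partial>M) - (\<integral>x. D x * g x \<partial>M)"
      using int f D by (simp add: right_diff_distrib mult.commute)
    ultimately show ?thesis using real by simp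
  qed (use lower[OF f] in auto)
  with gb show thesis by (rule that)
qed

text \<open>Around each of its points a strict superlevel set contains a weakly open half-space, on
  which an affine minorant is already above the level.\<close>

lemma (in finite_measure) convex_lsc_strong_imp_weak:
  assumes conv: "convex_on_L1 M F" and lsc: "lsc_wrt (L1_strong_topology M) F"
    and lower: "\<And>f. integrable M f \<Longrightarrow> ereal c \<le> F f"
  shows "lsc_wrt (L1_weak_topology M) F"
  unfolding lsc_wrt_def topspace_L1_weak
proof (rule allI, subst openin_subopen, intro ballI)
  fix a D assume "D \<in> {f \<in> L1_space M. a < F f}"
  then have D: "integrable M D" and aD: "a < F D" by auto
  \<comment> \<open>The level \<open>a\<close> may be infinite, so real heights are inserted:
    \<open>r\<close> is the height of the minorant at \<open>D\<close>, and the gap down to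
    \<open>s\<close> gives the half-space room around \<open>D\<close>.\<close>
  obtain r where r: "a < ereal r" "ereal r < F D" using ereal_dense2[OF aD] by auto
  obtain s where s: "a < ereal s" "s < r" using ereal_dense2[OF r(1)] by auto
  obtain g where g: "g \<in> bounded_measurable M"
    "\<And>f. integrable M f \<Longrightarrow> ereal (r + ((\<integral>x. f x * g x \<partial>M) - (\<integral>x. D x * g x \<partial>M))) \<le> F f"
    by (rule convex_lsc_affine_minorant[OF conv lsc lower D r(2)]) (assumption | rule that)+
  let ?T = "{f \<in> L1_space M. (\<integral>x. f x * g x \<partial>M) \<in> {(\<integral>x. D x * g x \<partial>M) - (r - s)<..}}"
  have "openin (L1_weak_topology M) ?T"
    unfolding L1_weak_topology_def
    using subsetD[OF bounded_measurable_subset_Linf g(1)] open_greaterThan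
    by (intro topology_generated_by_Basis) blast
  moreover have "D \<in> ?T" using D s(2) by simp
  moreover have "a < F f" if f: "f \<in> ?T" for f
  proof -
    have "ereal s \<le> ereal (r + ((\<integral>x. f x * g x \<partial>M) - (\<integral>x. D x * g x \<partial>M)))" using f by simp
    also have "\<dots> \<le> F f" using f by (intro g(2)) simp
    finally show ?thesis using s(1) by simp
  qed
  ultimately show "\<exists>T. openin (L1_weak_topology M) T \<and> D \<in> T \<and> T \<subseteq> {f \<in> L1_space M. a < F f}"
    by (intro exI[of _ ?T]) auto
qed


section \<open>Densities and contents\<close>

text \<open>The sign of \<open>D\<close> is not assumed. Its integrals over measurable sets are
  values of a measure, so \<open>D\<close> is nonnegative almost everywhere and the measure is
  \<open>density M D\<close>; this turns expectations into pairings with \<open>D\<close>.\<close>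

lemma content_of_density_ac:
  assumes D: "integrable M D" and ac: "content_of_density M D \<in> ac_prob_measures M"
  shows "(\<integral>x. D x \<partial>M) = 1"
    and "X \<in> bounded_measurable M
      \<Longrightarrow> content_integral M (content_of_density M D) X = (\<integral>x. D x * X x \<partial>M)"
proof -
  from ac obtain N where N: "prob_space N" "sets N = sets M" "absolutely_continuous M N"
    and eq: "content_of_density M D = restrict (measure N) (sets M)"
    by (auto simp: ac_prob_measures_def)
  interpret N: prob_space N by (rule N)
  have meas: "(LINT x:A|M. D x) = measure N A" if "A \<in> sets M" for A
    using fun_cong[OF eq, of A] that by (simp add: content_of_density_def)
  have int: "integrable M (\<lambda>x. indicator A x *\<^sub>R D x)" if "A \<in> sets M" for A
    using integrable_mult_indicator[OF that D] .
  show one: "(\<integral>x. D x \<partial>M) = 1"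
  proof -
    have "(LINT x:space M|M. D x) = 1"
      using N.prob_space sets_eq_imp_space_eq[OF N(2)] by (simp add: meas)
    then show ?thesis by (simp add: set_integral_space[OF D])
  qed
  have nonneg: "AE x in M. 0 \<le> D x"
  proof -
    \<comment> \<open>The integral of \<open>D\<close> over the set where it is negative is at most
      \<open>0\<close> by the sign and at least \<open>0\<close> as a measure, so this set is
      null.\<close>
    have neg: "{x \<in> space M. D x < 0} \<in> sets M" (is "?A \<in> _") using D by measurable
    have "(\<integral>x. - (indicator ?A x * D x) \<partial>M) = - measure N ?A"
      using meas[OF neg] by (simp add: set_lebesgue_integral_def)
    moreover have "0 \<le> (\<integral>x. - (indicator ?A x * D x) \<partial>M)"
      by (intro integral_nonneg_AE) (auto simp: indicator_def)
    ultimately have "(\<integral>x. - (indicator ?A x * D x) \<partial>M) = 0"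
      using measure_nonneg[of N ?A] by linarith
    then have "AE x in M. - (indicator ?A x * D x) = 0"
      using int[OF neg] by (subst (asm) integral_nonneg_eq_0_iff_AE) (auto simp: indicator_def)
    then show ?thesis using AE_space by eventually_elim (auto simp: indicator_def split: if_splits)
  qed
  have dens: "density M (\<lambda>x. ennreal (D x)) = N"
  proof (rule measure_eqI)
    fix A assume "A \<in> sets (density M (\<lambda>x. ennreal (D x)))"
    then have A: "A \<in> sets M" by simp
    have "emeasure (density M (\<lambda>x. ennreal (D x))) A = (\<integral>\<^sup>+x. ennreal (D x) * indicator A x \<partial>M)"
      using D A by (intro emeasure_density) auto
    also have "\<dots> = (\<integral>\<^sup>+x. ennreal (indicator A x *\<^sub>R D x) \<partial>M)"
      by (intro nn_integral_cong) (auto simp: indicator_def)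
    also have "\<dots> = ennreal (\<integral>x. indicator A x *\<^sub>R D x \<partial>M)"
      using nonneg by (intro nn_integral_eq_integral[OF int[OF A]]) (auto simp: indicator_def)
    also have "\<dots> = emeasure N A"
      using meas[OF A] by (simp add: set_lebesgue_integral_def N.emeasure_eq_measure)
    finally show "emeasure (density M (\<lambda>x. ennreal (D x))) A = emeasure N A" .
  qed (simp add: N(2))
  show "content_integral M (content_of_density M D) X = (\<integral>x. D x * X x \<partial>M)"
    if X: "X \<in> bounded_measurable M"
  proof -
    have "content_integral M (content_of_density M D) X = (\<integral>x. X x \<partial>N)"
      unfolding eq by (rule content_integral_eq_expectation[OF N(1,2) X])
    also have "\<dots> = (\<integral>x. D x * X x \<partial>M)"
      unfolding dens[symmetric] using D X nonneg
      by (subst integral_real_density) (auto simp: bounded_measurable_def)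
    finally show ?thesis .
  qed
qed

text \<open>A real version of the Radon-Nikodym derivative; integrating the constant
  \<open>1\<close> shows it to be integrable.\<close>

lemma (in sigma_finite_measure) ac_prob_measure_density:
  assumes "Q \<in> ac_prob_measures M"
  obtains D where "integrable M D" "content_of_density M D = Q"
proof -
  from assms obtain N where N: "prob_space N" "sets N = sets M" "absolutely_continuous M N"
    and Q: "Q = restrict (measure N) (sets M)" by (auto simp: ac_prob_measures_def)
  interpret N: prob_space N by (rule N)
  obtain D where D: "D \<in> borel_measurable M" "AE x in M. RN_deriv M N x = ennreal (D x)"
    "\<And>x. 0 \<le> D x"
    using real_RN_deriv[OF N.finite_measure_axioms N(3,2)] by metis
  have "N = density M (RN_deriv M N)" using density_RN_deriv[OF N(3,2)] by simp
  also have "\<dots> = density M (\<lambda>x. ennreal (D x))"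
    using D by (intro density_cong) auto
  finally have N_eq: "N = density M (\<lambda>x. ennreal (D x))" .
  have int: "integrable M D"
  proof -
    have "integrable N (\<lambda>x. 1 :: real)" by simp
    then have "integrable (density M (\<lambda>x. ennreal (D x))) (\<lambda>x. 1 :: real)" by (simp add: N_eq[symmetric])
    then show ?thesis using D by (subst (asm) integrable_real_density) auto
  qed
  have "(LINT x:A|M. D x) = measure N A" if A: "A \<in> sets M" for A
  proof -
    have "measure N A = (\<integral>x. indicator A x \<partial>N)" using A N(2) sets.Int_space_eq2 by simp
    also have "\<dots> = (\<integral>x. D x * indicator A x \<partial>M)"
      using D A by (subst N_eq, subst integral_real_density) auto
    finally show ?thesis by (simp add: set_lebesgue_integral_def mult.commute)
  qed
  then have "content_of_density M D = Q"
    by (auto simp: content_of_density_def Q restrict_def fun_eq_iff)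
  with int show thesis by (rule that)
qed

lemma density_penalty_eq_extend_penalty:
  "integrable M D \<Longrightarrow> density_penalty M K \<psi> D = extend_penalty K \<psi> (content_of_density M D)"
  by (simp add: density_penalty_def extend_penalty_def densities_def)

lemma content_of_density_lincomb:
  assumes "integrable M D" "integrable M E"
  shows "content_of_density M (\<lambda>x. a * D x + b * E x)
    = (\<lambda>A\<in>sets M. a * content_of_density M D A + b * content_of_density M E A)"
proof -
  have "(LINT x:A|M. a * D x + b * E x) = a * (LINT x:A|M. D x) + b * (LINT x:A|M. E x)"
    if A: "A \<in> sets M" for A
    using integrable_mult_indicator[OF A assms(1)] integrable_mult_indicator[OF A assms(2)]
    by (simp add: set_lebesgue_integral_def distrib_left mult.left_commute[of "indicator A _"])
  then show ?thesis by (auto simp: content_of_density_def restrict_def)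
qed

text \<open>On the densities of \<open>K\<close>, a convex set, the function is a supremum of linear
  functionals; elsewhere it is infinite.\<close>

lemma convex_on_L1_density_penalty:
  assumes K: "convex_content_set M K" "K \<subseteq> ac_prob_measures M"
    and lower: "\<forall>Q\<in>K. \<psi> Q \<noteq> -\<infinity>"
    and sup: "\<And>D. D \<in> densities M K \<Longrightarrow> density_penalty M K \<psi> D
      = (SUP X\<in>A. ereal (\<integral>x. D x * X x \<partial>M))"
    and A: "A \<subseteq> Linf_space M"
  shows "convex_on_L1 M (density_penalty M K \<psi>)"
  unfolding convex_on_L1_def
proof (intro ballI)
  let ?F = "density_penalty M K \<psi>"
  fix D E and t :: real
  assume DE: "D \<in> L1_space M" "E \<in> L1_space M" and t: "t \<in> {0..1}"
  have ninf: "?F f \<noteq> -\<infinity>" for f using lower by (auto simp: density_penalty_def densities_def)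
  show "?F (\<lambda>x. t * D x + (1 - t) * E x) \<le> ereal t * ?F D + ereal (1 - t) * ?F E"
  \<comment> \<open>At the endpoints \<open>0 * \<infinity> = 0\<close> in \<open>ereal\<close>, so
    an infinite value need not make the right-hand side infinite.\<close>
  proof (cases "t = 0 \<or> t = 1")
    case True
    then show ?thesis by (auto simp: zero_ereal_def[symmetric] one_ereal_def[symmetric])
  next
    case False
    then have t0: "0 < t" "0 < 1 - t" using t by auto
    show ?thesis
    proof (cases "D \<in> densities M K \<and> E \<in> densities M K")
      case False
      then have "?F D = \<infinity> \<or> ?F E = \<infinity>" by (auto simp: density_penalty_def)
      then have "ereal t * ?F D + ereal (1 - t) * ?F E = \<infinity>"
        using t0 ninf[of D] ninf[of E] by (cases "?F D"; cases "?F E") auto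
      then show ?thesis by (simp only: ereal_less_eq(1))
    next
      case True
      have "(\<lambda>x. t * D x + (1 - t) * E x) \<in> densities M K"
        using True K(1) t by (simp add: densities_def content_of_density_lincomb convex_content_set_def)
      then have "?F (\<lambda>x. t * D x + (1 - t) * E x)
          = (SUP X\<in>A. ereal (\<integral>x. (t * D x + (1 - t) * E x) * X x \<partial>M))"
        by (rule sup)
      also have "\<dots> \<le> ereal t * ?F D + ereal (1 - t) * ?F E"
      proof (rule SUP_least)
        fix X assume X: "X \<in> A"
        have int: "integrable M (\<lambda>x. f x * X x)" if "integrable M f" for f
          using that Linf_pairing[of X M] A X by blast
        have "(\<integral>x. (t * D x + (1 - t) * E x) * X x \<partial>M)
            = (\<integral>x. t * (D x * X x) + (1 - t) * (E x * X x) \<partial>M)"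
          by (simp add: algebra_simps)
        also have "\<dots> = t * (\<integral>x. D x * X x \<partial>M) + (1 - t) * (\<integral>x. E x * X x \<partial>M)"
          using int DE by simp
        finally have "ereal (\<integral>x. (t * D x + (1 - t) * E x) * X x \<partial>M)
            = ereal t * ereal (\<integral>x. D x * X x \<partial>M) + ereal (1 - t) * ereal (\<integral>x. E x * X x \<partial>M)"
          by simp
        also have "\<dots> \<le> ereal t * ?F D + ereal (1 - t) * ?F E"
          using True X t by (intro add_mono ereal_mult_left_mono) (auto simp: sup intro: SUP_upper)
        finally show "ereal (\<integral>x. (t * D x + (1 - t) * E x) * X x \<partial>M)
            \<le> ereal t * ?F D + ereal (1 - t) * ?F E" .
      qed
      finally show ?thesis .
    qed
  qed
qed

text \<open>A strict superlevel set is the complement of the closed set of densities together with a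
  union of open half-spaces.\<close>

lemma lsc_density_penalty:
  assumes closed: "closedin (L1_strong_topology M) (densities M K)"
    and sup: "\<And>D. D \<in> densities M K \<Longrightarrow> density_penalty M K \<psi> D
      = (SUP X\<in>A. ereal (\<integral>x. D x * X x \<partial>M))"
    and A: "A \<subseteq> Linf_space M"
  shows "lsc_wrt (L1_strong_topology M) (density_penalty M K \<psi>)"
  unfolding lsc_wrt_def topspace_L1_strong
proof
  fix a
  let ?F = "density_penalty M K \<psi>"
  let ?H = "\<lambda>X. {f \<in> L1_space M. (\<integral>x. f x * X x \<partial>M) \<in> {y. a < ereal y}}"
  show "openin (L1_strong_topology M) {f \<in> L1_space M. a < ?F f}"
  \<comment> \<open>At level \<infinity> the superlevel set is empty, whereas the union used below
    contains the complement of the densities.\<close>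
  proof (cases "a = \<infinity>")
    case True
    then show ?thesis by simp
  next
    case False
    have "open {y. a < ereal y}"
      using open_ereal_vimage[OF open_greaterThan[of a]] by (simp add: vimage_def)
    then have "openin (L1_strong_topology M) (?H X)" if "X \<in> A" for X
      using that A by (intro openin_L1_strong_halfspace) auto
    then have "openin (L1_strong_topology M) (\<Union>X\<in>A. ?H X)" by (intro openin_Union) auto
    moreover have "openin (L1_strong_topology M) (L1_space M - densities M K)"
      using closed by (simp add: closedin_def)
    ultimately have "openin (L1_strong_topology M) ((L1_space M - densities M K) \<union> (\<Union>X\<in>A. ?H X))"
      by (intro openin_Un)
    moreover have "{f \<in> L1_space M. a < ?F f} = (L1_space M - densities M K) \<union> (\<Union>X\<in>A. ?H X)"
    proof (rule set_eqI)
      fix f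
      show "f \<in> {f \<in> L1_space M. a < ?F f} \<longleftrightarrow> f \<in> (L1_space M - densities M K) \<union> (\<Union>X\<in>A. ?H X)"
      proof (cases "f \<in> densities M K")
        case True
        then show ?thesis by (auto simp: sup less_SUP_iff)
      next
        case nd: False
        then have "?F f = \<infinity>" by (simp add: density_penalty_def)
        then show ?thesis using nd False by (auto simp: less_top)
      qed
    qed
    ultimately show ?thesis by simp
  qed
qed


section \<open>Penalty functions and minimal penalties\<close>

text \<open>The two conjuncts are assertions (a) and (b). Convexity of \<Psi> is a premise of the
  second: a minimal penalty is a supremum of functionals affine in the measure, so the equality in
  (b) itself forces \<Psi> to be convex.\<close>

theorem lemma2p1:
  fixes M :: "'a measure"
    and K :: "('a set \<Rightarrow> real) set"
    and \<psi> :: "('a set \<Rightarrow> real) \<Rightarrow> ereal"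
  assumes "prob_space M"
    and "K \<subseteq> ac_prob_measures M"
    and "convex_content_set M K"
    and "closedin (L1_strong_topology M) (densities M K)"
    and "\<forall>Q\<in>K. \<psi> Q \<noteq> -\<infinity>"
    and "\<exists>c::real. (INF Q\<in>K. \<psi> Q) = ereal c"
  defines "\<psi>' \<equiv> extend_penalty K \<psi>"
    and "\<Psi> \<equiv> density_penalty M K \<psi>"
    and "\<rho> \<equiv> risk_measure_of M (extend_penalty K \<psi>)"
  shows
    "((\<forall>Q\<in>prob_contents M. \<psi>' Q = minimal_penalty M \<rho> Q) \<longrightarrow>
        proper_on_L1 M \<Psi> \<and> convex_on_L1 M \<Psi> \<and>
        lsc_wrt (L1_strong_topology M) \<Psi> \<and>
        (lsc_wrt (L1_strong_topology M) \<Psi> \<longleftrightarrow> lsc_wrt (L1_weak_topology M) \<Psi>)) \<and>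
     (convex_on_L1 M \<Psi> \<longrightarrow>
        (lsc_wrt (L1_strong_topology M) \<Psi> \<longleftrightarrow> lsc_wrt (L1_weak_topology M) \<Psi>) \<and>
        (lsc_wrt (L1_strong_topology M) \<Psi> \<longrightarrow>
           (\<forall>Q\<in>ac_prob_measures M. \<psi>' Q = minimal_penalty M \<rho> Q)))"
proof -
  interpret prob_space M by (rule assms(1))
  note K = assms(2)
  obtain c :: real where c: "(INF Q\<in>K. \<psi> Q) = ereal c" using assms(6) by blast
  have Kc: "K \<subseteq> prob_contents M" using K ac_prob_measures_subset by blast
  \<comment> \<open>Extension by \<infinity> does not change the infimum, so the supremum defining
    \<rho> is real.\<close>
  have fin: "\<bar>INF Q\<in>prob_contents M. extend_penalty K \<psi> Q\<bar> \<noteq> \<infinity>"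
    by (simp add: INF_extend_penalty[OF Kc] c)
  have lower: "ereal c \<le> \<Psi> f" for f
    by (auto simp: \<Psi>_def density_penalty_def densities_def c[symmetric] intro: INF_lower)
  have equiv: "lsc_wrt (L1_strong_topology M) \<Psi> \<longleftrightarrow> lsc_wrt (L1_weak_topology M) \<Psi>"
    if "convex_on_L1 M \<Psi>"
    using convex_lsc_strong_imp_weak[OF that _ lower] lsc_L1_weak_imp_strong by blast

  \<comment> \<open>Regularity of a penalty that is minimal\<close>
  have "proper_on_L1 M \<Psi> \<and> convex_on_L1 M \<Psi> \<and> lsc_wrt (L1_strong_topology M) \<Psi>"
    if min: "\<forall>Q\<in>prob_contents M. \<psi>' Q = minimal_penalty M \<rho> Q"
  proof -
    \<comment> \<open>Negated acceptable positions act by pairing on densities, which exhibits the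
      minimal penalty as a supremum of continuous linear functionals.\<close>
    let ?A = "(\<lambda>X x. - X x) ` acceptance_set M \<rho>"
    have A: "?A \<subseteq> Linf_space M"
      using bounded_measurable_subset_Linf bounded_measurable_uminus
      by (fastforce simp: acceptance_set_def)
    have sup: "\<Psi> D = (SUP X\<in>?A. ereal (\<integral>x. D x * X x \<partial>M))" if D: "D \<in> densities M K" for D
    proof -
      have D': "integrable M D" "content_of_density M D \<in> K" using D by (auto simp: densities_def)
      have "\<Psi> D = minimal_penalty M \<rho> (content_of_density M D)"
        using bspec[OF min subsetD[OF Kc D'(2)]] D'(1)
        by (simp add: \<Psi>_def \<psi>'_def density_penalty_eq_extend_penalty)
      also have "\<dots> = (SUP X\<in>acceptance_set M \<rho>. ereal (\<integral>x. D x * - X x \<partial>M))"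
        unfolding minimal_penalty_def
        using D' K by (intro SUP_cong refl)
          (auto simp: content_of_density_ac bounded_measurable_uminus acceptance_set_def)
      finally show ?thesis by (simp add: image_image)
    qed
    have "convex_on_L1 M \<Psi>" "lsc_wrt (L1_strong_topology M) \<Psi>"
      unfolding \<Psi>_def
      by (rule convex_on_L1_density_penalty[OF assms(3) K assms(5) sup[unfolded \<Psi>_def] A]
          lsc_density_penalty[OF assms(4) sup[unfolded \<Psi>_def] A], assumption)+
    moreover have "proper_on_L1 M \<Psi>"
    proof -
      have "\<exists>Q\<in>K. \<psi> Q \<noteq> \<infinity>"
      proof (rule ccontr)
        assume "\<not> (\<exists>Q\<in>K. \<psi> Q \<noteq> \<infinity>)"
        then have "(\<infinity>::ereal) \<le> (INF Q\<in>K. \<psi> Q)" by (intro INF_greatest) simp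
        then show False using c by simp
      qed
      then obtain Q where Q: "Q \<in> K" "\<psi> Q \<noteq> \<infinity>" by blast
      then obtain D where "integrable M D" "content_of_density M D = Q"
        using ac_prob_measure_density K by blast
      then have "D \<in> L1_space M" "\<Psi> D \<noteq> \<infinity>"
        using Q by (auto simp: \<Psi>_def density_penalty_def densities_def)
      moreover have "\<Psi> f \<noteq> -\<infinity>" for f using lower[of f] by auto
      ultimately show ?thesis unfolding proper_on_L1_def by blast
    qed
    ultimately show ?thesis by blast
  qed

  \<comment> \<open>Minimality of a convex lower semicontinuous penalty\<close>
  moreover have "\<psi>' Q = minimal_penalty M \<rho> Q"
    if conv: "convex_on_L1 M \<Psi>" and lsc: "lsc_wrt (L1_strong_topology M) \<Psi>"
      and Q: "Q \<in> ac_prob_measures M" for Q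
  proof (rule antisym)
    have Qc: "Q \<in> prob_contents M" using Q ac_prob_measures_subset by blast
    \<comment> \<open>The easy half: for acceptable \<open>X\<close> and finite penalty, the
      expectation of \<open>- X\<close> minus the penalty is at most \<open>\<rho> X\<close>, hence
      at most \<open>0\<close>.\<close>
    show "minimal_penalty M \<rho> Q \<le> \<psi>' Q"
      unfolding minimal_penalty_def
    proof (rule SUP_least)
      fix X assume "X \<in> acceptance_set M \<rho>"
      then have X: "X \<in> bounded_measurable M" "\<rho> X \<le> 0" by (auto simp: acceptance_set_def)
      show "ereal (content_integral M Q (\<lambda>x. - X x)) \<le> \<psi>' Q"
      proof (cases "\<psi>' Q")
        case (real r)
        then show ?thesis
          using risk_measure_of_upper[where \<phi> = "extend_penalty K \<psi>", OF fin X(1) Qc] X(2)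
          by (fastforce simp: \<rho>_def \<psi>'_def)
      next
        case MInf
        then show ?thesis using assms(5) by (auto simp: \<psi>'_def extend_penalty_def split: if_splits)
      qed simp
    qed
    obtain D where D: "integrable M D" "content_of_density M D = Q"
      using ac_prob_measure_density[OF Q] by blast
    have \<Psi>D: "\<Psi> D = \<psi>' Q"
      using D by (simp add: \<Psi>_def \<psi>'_def density_penalty_eq_extend_penalty)
    show "\<psi>' Q \<le> minimal_penalty M \<rho> Q"
    proof (rule dense_le)
      fix y assume y: "y < \<psi>' Q"
      show "y \<le> minimal_penalty M \<rho> Q"
      proof (cases y)
        case (real a)
        obtain g where g: "g \<in> bounded_measurable M"
          and minorant: "\<And>f. integrable M f
            \<Longrightarrow> ereal (a + ((\<integral>x. f x * g x \<partial>M) - (\<integral>x. D x * g x \<partial>M))) \<le> \<Psi> f"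
          using convex_lsc_affine_minorant[OF conv lsc lower D(1)] y real \<Psi>D by metis
        define b where "b = (\<integral>x. D x * g x \<partial>M) - a"
        let ?X = "\<lambda>x. b - g x"
        have gX: "(\<lambda>x. - ?X x) \<in> bounded_measurable M" and X: "?X \<in> bounded_measurable M"
          using bounded_measurable_lincomb[OF g bounded_measurable_const[of b], of 1 "-1"]
            bounded_measurable_lincomb[OF g bounded_measurable_const[of b], of "-1" 1] by simp_all
        \<comment> \<open>The constant \<open>b\<close> is unaffected because a density of a
          probability measure integrates to \<open>1\<close>.\<close>
        have eval: "content_integral M (content_of_density M f) (\<lambda>x. - ?X x) = (\<integral>x. f x * g x \<partial>M) - b"
          if f: "integrable M f" "content_of_density M f \<in> ac_prob_measures M" for f
        proof -
          have int: "integrable M (\<lambda>x. f x * g x)"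
            using Linf_pairing[of g M] g bounded_measurable_subset_Linf[of M] f(1) by blast
          have "(\<integral>x. f x * - ?X x \<partial>M) = (\<integral>x. f x * g x - b * f x \<partial>M)"
            by (simp add: algebra_simps)
          also have "\<dots> = (\<integral>x. f x * g x \<partial>M) - b"
            using int f(1) content_of_density_ac(1)[OF f] by simp
          finally show ?thesis using content_of_density_ac(2)[OF f gX] by simp
        qed
        have "\<rho> ?X \<le> 0"
          unfolding \<rho>_def
        \<comment> \<open>Only measures in \<open>K\<close> with finite penalty count; for their
          densities acceptability is exactly the minorant inequality.\<close>
        proof (rule risk_measure_of_least[OF fin X])
          fix R r assume R: "R \<in> prob_contents M" "extend_penalty K \<psi> R = ereal r"
          then have RK: "R \<in> K" by (auto simp: extend_penalty_def split: if_splits)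
          then obtain f where f: "integrable M f" "content_of_density M f = R"
            using ac_prob_measure_density K by blast
          have "a + ((\<integral>x. f x * g x \<partial>M) - (\<integral>x. D x * g x \<partial>M)) \<le> r"
            using minorant[OF f(1)] R(2) f
            by (simp add: \<Psi>_def density_penalty_eq_extend_penalty)
          then show "content_integral M R (\<lambda>x. - ?X x) - r \<le> 0"
            using eval[OF f(1)] f(2) RK K by (auto simp: b_def)
        qed
        then have "?X \<in> acceptance_set M \<rho>" using X by (simp add: acceptance_set_def)
        then have "ereal (content_integral M Q (\<lambda>x. - ?X x)) \<le> minimal_penalty M \<rho> Q"
          unfolding minimal_penalty_def by (rule SUP_upper)
        \<comment> \<open>At \<open>D\<close> the minorant has height \<open>a\<close>, so this one
          position already attains the value \<open>a\<close>.\<close>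
        moreover have "content_integral M Q (\<lambda>x. - ?X x) = a"
          using eval[OF D(1)] D(2) Q by (simp add: b_def)
        ultimately show ?thesis using real by simp
      qed (use y in auto)
    qed
  qed
  ultimately show ?thesis using equiv by blast
qed

end
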